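(* Let $\mathcal{C}$ be a class of finitely presented groups closed under taking finite index subgroups and let $\mathcal{K}\in\{\mathrm{Fin},\mathrm{Coset},\mathrm{Rat},\mathrm{Rec},\mathrm{Alg},\mathrm{CF}\}$. If all groups in $\mathcal{C}$ are $\mathcal{K}$-generalized twisted conjugacy separable with respect to virtually inner automorphisms and $G$ is a group having a finite index subgroup belonging to $\mathcal{C}$, then $G$ is $\mathcal{K}$-generalized conjugacy separable.
   Context: Maps are written on the right. The profinite topology on a group has as basis the cosets of finite index subgroups; a subset is separable if it is closed in this topology. An automorphism $\phi$ is virtually inner if $\phi^k$ is inner for some $k>0$; $\mathrm{Via}(G)$ is the set of virtually inner automorphisms of $G$. Classes of subsets of a finitely generated group $G=\langle A\rangle$ ($A$ finite), with $\widetilde A=A\cup A^{-1}$ and canonical surjective homomorphism $\pi:\widetilde A^*\to G$: $\mathrm{Fin}(G)$ is the class of finite subsets; $\mathrm{Coset}(G)$ the class of cosets of finitely generated subgroups; $\mathrm{Rat}(G)$ the class of sets $L\pi$ with $L\subseteq\widetilde A^*$ a rational language; $\mathrm{Rec}(G)$ the class of subsets $K$ with $K\pi^{-1}$ a rational language; $\mathrm{Alg}(G)$ the class of sets $L\pi$ with $L\subseteq\widetilde A^*$ a context-free language; $\mathrm{CF}(G)$ the class of subsets $K$ with $K\pi^{-1}$ a context-free language. These do not depend on the choice of $A$. A group $G$ is $\mathcal{K}$-generalized conjugacy separable if $\{x^{-1}sx\mid x\in G,\ s\in K\}$ is separable for all $K\in\mathcal{K}(G)$; it is $\mathcal{K}$-generalized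 twisted conjugacy separable with respect to virtually inner automorphisms if $\{(x^{-1}\phi)sx\mid x\in G,\ s\in K\}$ is separable for all $K\in\mathcal{K}(G)$ and all $\phi\in\mathrm{Via}(G)$. *)

theory Defs
  imports "HOL-Algebra.Bij" "HOL-Algebra.Generated_Groups" "HOL-Analysis.Function_Topology"
begin

section \<open>Rational and context-free languages\<close>

text \<open>The rational languages over the (finite) alphabet \<open>\<Sigma>\<close>: the smallest family containing the
  finite languages and closed under union, product and star.\<close>

inductive_set rational_languages :: "'t set \<Rightarrow> 't list set set" for \<Sigma> :: "'t set" where
  finite: "finite L \<Longrightarrow> L \<subseteq> lists \<Sigma> \<Longrightarrow> L \<in> rational_languages \<Sigma>"
| union: "L \<in> rational_languages \<Sigma> \<Longrightarrow> M \<in> rational_languages \<Sigma> \<Longrightarrow> L \<union> M \<in> rational_languages \<Sigma>"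
| product: "L \<in> rational_languages \<Sigma> \<Longrightarrow> M \<in> rational_languages \<Sigma> \<Longrightarrow>
    {u @ v | u v. u \<in> L \<and> v \<in> M} \<in> rational_languages \<Sigma>"
| star: "L \<in> rational_languages \<Sigma> \<Longrightarrow> concat ` lists L \<in> rational_languages \<Sigma>"

datatype ('n, 't) grammar_symbol = Nonterminal 'n | Terminal 't

text \<open>One-step derivations with respect to a set \<open>P\<close> of context-free productions \<open>(A, \<gamma>)\<close>.\<close>

inductive derives_step ::
  "('n \<times> ('n, 't) grammar_symbol list) set \<Rightarrow>
    ('n, 't) grammar_symbol list \<Rightarrow> ('n, 't) grammar_symbol list \<Rightarrow> bool"
  for P where
  "(A, \<gamma>) \<in> P \<Longrightarrow> derives_step P (\<alpha> @ [Nonterminal A] @ \<beta>) (\<alpha> @ \<gamma> @ \<beta>)"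

text \<open>A grammar has finitely many nonterminals, so they can be taken to be natural numbers.\<close>

definition context_free_languages :: "'t set \<Rightarrow> 't list set set" where
  "context_free_languages \<Sigma> =
    {{w \<in> lists \<Sigma>. (derives_step P)\<^sup>*\<^sup>* [Nonterminal S] (map Terminal w)} | P (S :: nat).
      finite P \<and> (\<forall>(A, \<gamma>) \<in> P. \<forall>a. Terminal a \<in> set \<gamma> \<longrightarrow> a \<in> \<Sigma>)}"

section \<open>Words over a generating set and finite presentations\<close>

text \<open>The letter \<open>(a, True)\<close> stands for \<open>a\<close> and \<open>(a, False)\<close> for its formal inverse.\<close>

abbreviation signed_letters :: "'x set \<Rightarrow> ('x \<times> bool) set" where
  "signed_letters A \<equiv> A \<times> UNIV"

definition word_eval :: "('a, 'm) monoid_scheme \<Rightarrow> ('a \<times> bool) list \<Rightarrow> 'a" where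
  "word_eval G w = foldr (\<lambda>(a, b) y. (if b then a else inv\<^bsub>G\<^esub> a) \<otimes>\<^bsub>G\<^esub> y) w \<one>\<^bsub>G\<^esub>"

definition finite_generating_set :: "('a, 'm) monoid_scheme \<Rightarrow> 'a set \<Rightarrow> bool" where
  "finite_generating_set G A \<longleftrightarrow> finite A \<and> A \<subseteq> carrier G \<and> generate G A = carrier G"

text \<open>The congruence on words over \<open>signed_letters X\<close> generated by the pairs \<open>(x x\<inverse>, 1)\<close>,
  \<open>(x\<inverse> x, 1)\<close> for \<open>x \<in> X\<close> and \<open>(r, 1)\<close> for \<open>r \<in> R\<close>. Its quotient is the group given by the
  presentation with generators \<open>X\<close> and relators \<open>R\<close>.\<close>

inductive_set presentation_cong :: "'x set \<Rightarrow> ('x \<times> bool) list set \<Rightarrow>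
    (('x \<times> bool) list \<times> ('x \<times> bool) list) set"
  for X :: "'x set" and R :: "('x \<times> bool) list set" where
  refl: "u \<in> lists (signed_letters X) \<Longrightarrow> (u, u) \<in> presentation_cong X R"
| sym: "(u, v) \<in> presentation_cong X R \<Longrightarrow> (v, u) \<in> presentation_cong X R"
| trans: "(u, v) \<in> presentation_cong X R \<Longrightarrow> (v, w) \<in> presentation_cong X R \<Longrightarrow>
    (u, w) \<in> presentation_cong X R"
| mult: "(u, v) \<in> presentation_cong X R \<Longrightarrow> (u', v') \<in> presentation_cong X R \<Longrightarrow>
    (u @ u', v @ v') \<in> presentation_cong X R"
| cancel: "x \<in> X \<Longrightarrow> ([(x, b), (x, \<not> b)], []) \<in> presentation_cong X R"
| relator: "r \<in> R \<Longrightarrow> r \<in> lists (signed_letters X) \<Longrightarrow> (r, []) \<in> presentation_cong X R"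

definition presented_group :: "'x set \<Rightarrow> ('x \<times> bool) list set \<Rightarrow> ('x \<times> bool) list set monoid" where
  "presented_group X R =
    \<lparr>carrier = lists (signed_letters X) // presentation_cong X R,
     mult = (\<lambda>U V. \<Union>u\<in>U. \<Union>v\<in>V. presentation_cong X R `` {u @ v}),
     one = presentation_cong X R `` {[]}\<rparr>"

definition finitely_presented :: "('a, 'm) monoid_scheme \<Rightarrow> bool" where
  "finitely_presented G \<longleftrightarrow>
    (\<exists>(X :: nat set) R. finite X \<and> finite R \<and> R \<subseteq> lists (signed_letters X) \<and>
      G \<cong> presented_group X R)"

section \<open>Classes of subsets of a finitely generated group\<close>

text \<open>The classes \<open>Rat\<close>, \<open>Rec\<close>, \<open>Alg\<close> and \<open>CF\<close> do not depend on the choice of the finite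
  generating set, so it is existentially quantified.\<close>

definition Fin :: "('a, 'm) monoid_scheme \<Rightarrow> 'a set set" where
  "Fin G = {K. K \<subseteq> carrier G \<and> finite K}"

text \<open>Right cosets suffice: the left coset \<open>g H\<close> is the right coset of \<open>g H g\<inverse>\<close> containing \<open>g\<close>,
  and \<open>g H g\<inverse>\<close> is finitely generated if \<open>H\<close> is.\<close>

definition Coset :: "('a, 'm) monoid_scheme \<Rightarrow> 'a set set" where
  "Coset G = {generate G S #>\<^bsub>G\<^esub> g | S g. finite S \<and> S \<subseteq> carrier G \<and> g \<in> carrier G}"

definition Rat :: "('a, 'm) monoid_scheme \<Rightarrow> 'a set set" where
  "Rat G = {word_eval G ` L | A L. finite_generating_set G A \<and>
    L \<in> rational_languages (signed_letters A)}"

definition Rec :: "('a, 'm) monoid_scheme \<Rightarrow> 'a set set" where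
  "Rec G = {K. K \<subseteq> carrier G \<and> (\<exists>A. finite_generating_set G A \<and>
    {w \<in> lists (signed_letters A). word_eval G w \<in> K} \<in> rational_languages (signed_letters A))}"

definition Alg :: "('a, 'm) monoid_scheme \<Rightarrow> 'a set set" where
  "Alg G = {word_eval G ` L | A L. finite_generating_set G A \<and>
    L \<in> context_free_languages (signed_letters A)}"

definition CF :: "('a, 'm) monoid_scheme \<Rightarrow> 'a set set" where
  "CF G = {K. K \<subseteq> carrier G \<and> (\<exists>A. finite_generating_set G A \<and>
    {w \<in> lists (signed_letters A). word_eval G w \<in> K} \<in> context_free_languages (signed_letters A))}"

section \<open>Separability\<close>

definition finite_index_subgroup :: "'a set \<Rightarrow> ('a, 'm) monoid_scheme \<Rightarrow> bool" where
  "finite_index_subgroup H G \<longleftrightarrow> subgroup H G \<and> finite (rcosets\<^bsub>G\<^esub> H)"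

text \<open>Each left coset of a finite index subgroup is a right coset of a conjugate, which has the same
  index, and the intersection of two such cosets is empty or again such a coset. So the right cosets
  form a basis, not just a subbasis, of the topology they generate.\<close>

definition profinite_topology :: "('a, 'm) monoid_scheme \<Rightarrow> 'a topology" where
  "profinite_topology G =
    topology_generated_by (\<Union>H \<in> {H. finite_index_subgroup H G}. rcosets\<^bsub>G\<^esub> H)"

definition separable :: "('a, 'm) monoid_scheme \<Rightarrow> 'a set \<Rightarrow> bool" where
  "separable G S \<longleftrightarrow> closedin (profinite_topology G) S"

text \<open>Maps act on the right, so the inner automorphism of \<open>g\<close> is \<open>x \<mapsto> g\<inverse> x g\<close>.\<close>

definition Via :: "('a, 'm) monoid_scheme \<Rightarrow> ('a \<Rightarrow> 'a) set" where
  "Via G = {\<phi> \<in> auto G. \<exists>k>0. \<exists>g \<in> carrier G. \<forall>x \<in> carrier G.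
    (\<phi> ^^ k) x = inv\<^bsub>G\<^esub> g \<otimes>\<^bsub>G\<^esub> x \<otimes>\<^bsub>G\<^esub> g}"

definition generalized_conjugacy_separable ::
  "(('a, 'm) monoid_scheme \<Rightarrow> 'a set set) \<Rightarrow> ('a, 'm) monoid_scheme \<Rightarrow> bool" where
  "generalized_conjugacy_separable \<K> G \<longleftrightarrow>
    (\<forall>K \<in> \<K> G. separable G {inv\<^bsub>G\<^esub> x \<otimes>\<^bsub>G\<^esub> s \<otimes>\<^bsub>G\<^esub> x | x s. x \<in> carrier G \<and> s \<in> K})"

definition generalized_twisted_conjugacy_separable_Via ::
  "(('a, 'm) monoid_scheme \<Rightarrow> 'a set set) \<Rightarrow> ('a, 'm) monoid_scheme \<Rightarrow> bool" where
  "generalized_twisted_conjugacy_separable_Via \<K> G \<longleftrightarrow>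
    (\<forall>K \<in> \<K> G. \<forall>\<phi> \<in> Via G.
      separable G {\<phi> (inv\<^bsub>G\<^esub> x) \<otimes>\<^bsub>G\<^esub> s \<otimes>\<^bsub>G\<^esub> x | x s. x \<in> carrier G \<and> s \<in> K})"

end

theory Submission
  imports Defs
begin

text \<open>Let \<open>U\<close> be the given finite index subgroup of \<open>G\<close>. Its normal core \<open>N\<close> has finite index in \<open>U\<close>,
  so it belongs to \<open>\<C>\<close> as well and the separability hypothesis holds for it. Let \<open>T\<close> be a
  finite set of representatives of the right cosets of \<open>N\<close>. Splitting the conjugating and the
  conjugated element along \<open>T\<close> shows that the union of the conjugacy classes of the elements of \<open>K\<close>
  is a finite union of translates, by elements of \<open>G\<close> on both sides, of the sets
  \<open>D\<^sub>t = {(t m\<inverse> t\<inverse>) n m | m n. m \<in> N \<and> n \<in> t K \<inter> N}\<close> for \<open>t \<in> T\<close> (lemma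
  \<open>conjugacy_closure_decomposition\<close>). The automorphism \<open>y \<mapsto> t y t\<inverse>\<close> of \<open>N\<close> is virtually inner because
  a power of \<open>t\<close> lies in \<open>N\<close>. So \<open>D\<^sub>t\<close> is separable in \<open>N\<close> as soon as \<open>t K \<inter> N\<close> belongs to the
  corresponding class of subsets of \<open>N\<close>. A set separable in \<open>N\<close> is separable in \<open>G\<close>, since \<open>N\<close> has
  finite index, and translations are homeomorphisms of the profinite topology.

  The main work is to show that \<open>t K \<inter> N\<close> is empty or stays in the class (theorem
  \<open>class_translate_restrict\<close>). This is clear for finite sets, and for cosets it is Schreier's lemma.
  The other four classes come from two closure properties: rational and context-free languages are
  closed under finite-state transductions (\<open>transduction_rational\<close>,
  \<open>transduction_context_free\<close>). For \<^const>\<open>Rat\<close> and \<^const>\<open>Alg\<close>, a transducer with the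
  representatives as states rewrites a word for \<open>s\<close> over generators of \<open>G\<close> into a word for \<open>t s\<close> over
  generators of \<open>N\<close>, if \<open>t s\<close> lies in \<open>N\<close> (\<open>restriction_transducer\<close>). For \<^const>\<open>Rec\<close> and
  \<^const>\<open>CF\<close>, the words over generators of \<open>N\<close> with value in \<open>t K\<close> form an inverse homomorphic image
  of a quotient of the language of \<open>K\<close>, which is again a transduction
  (\<open>preimage_transducer\<close>).\<close>

section \<open>Finite-state transducers\<close>

text \<open>A transducer is its set of transitions: \<open>(p, a, x, q)\<close> reads the letter \<open>a\<close> in state \<open>p\<close>,
  writes the word \<open>x\<close> and moves to state \<open>q\<close>. Every step reads exactly one letter, so a finite
  transducer has finitely many outputs on a given word.\<close>

inductive run :: "('q \<times> 'a \<times> 'b list \<times> 'q) set \<Rightarrow> 'q \<Rightarrow> 'a list \<Rightarrow> 'b list \<Rightarrow> 'q \<Rightarrow> bool"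
  for \<delta> where
  nil: "run \<delta> p [] [] p"
| step: "(p, a, x, q) \<in> \<delta> \<Longrightarrow> run \<delta> q w y r \<Longrightarrow> run \<delta> p (a # w) (x @ y) r"

definition transduction ::
  "('q \<times> 'a \<times> 'b list \<times> 'q) set \<Rightarrow> 'q \<Rightarrow> 'q \<Rightarrow> 'a list set \<Rightarrow> 'b list set" where
  "transduction \<delta> p q L = {y. \<exists>w\<in>L. run \<delta> p w y q}"

definition states :: "('q \<times> 'a \<times> 'b list \<times> 'q) set \<Rightarrow> 'q set" where
  "states \<delta> = (\<Union>(p, a, x, q)\<in>\<delta>. {p, q})"

definition outputs_over :: "('q \<times> 'a \<times> 'b list \<times> 'q) set \<Rightarrow> 'b set \<Rightarrow> bool" where
  "outputs_over \<delta> \<Gamma> \<longleftrightarrow> (\<forall>(p, a, x, q)\<in>\<delta>. x \<in> lists \<Gamma>)"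

lemma finite_states: "finite \<delta> \<Longrightarrow> finite (states \<delta>)"
  by (auto simp: states_def)

lemma transition_in_states: "(p, a, x, q) \<in> \<delta> \<Longrightarrow> p \<in> states \<delta> \<and> q \<in> states \<delta>"
  unfolding states_def by blast

inductive_cases run_nilE: "run \<delta> p [] y q"
inductive_cases run_consE: "run \<delta> p (a # w) y q"

lemma run_end: "run \<delta> p w y q \<Longrightarrow> q \<in> insert p (states \<delta>)"
  by (induction rule: run.induct) (use transition_in_states in fast)+

lemma run_output: "run \<delta> p w y q \<Longrightarrow> outputs_over \<delta> \<Gamma> \<Longrightarrow> y \<in> lists \<Gamma>"
  by (induction rule: run.induct) (auto simp: outputs_over_def)

lemma run_append_intro:
  "run \<delta> p u x r \<Longrightarrow> run \<delta> r v y q \<Longrightarrow> run \<delta> p (u @ v) (x @ y) q"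
  by (induction rule: run.induct) (simp_all add: run.step)

lemma run_append_split:
  "run \<delta> p (u @ v) y q \<Longrightarrow> \<exists>y1 y2 r. y = y1 @ y2 \<and> run \<delta> p u y1 r \<and> run \<delta> r v y2 q"
proof (induction u arbitrary: p y)
  case Nil
  then show ?case using run.nil[of \<delta> p] by fastforce
next
  case (Cons a u)
  then obtain x p' y' where 1: "y = x @ y'" "(p, a, x, p') \<in> \<delta>" "run \<delta> p' (u @ v) y' q"
    by (auto elim: run_consE)
  with Cons.IH obtain y1 y2 r where "y' = y1 @ y2" "run \<delta> p' u y1 r" "run \<delta> r v y2 q"
    by blast
  with 1 show ?case using run.step[OF 1(2)]
    by (intro exI[of _ "x @ y1"] exI[of _ y2] exI[of _ r]) simp
qed

lemma run_append:
  "run \<delta> p (u @ v) y q \<longleftrightarrow> (\<exists>y1 y2 r. y = y1 @ y2 \<and> run \<delta> p u y1 r \<and> run \<delta> r v y2 q)"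
  using run_append_intro run_append_split by fast

lemma finite_run_outputs:
  assumes "finite \<delta>"
  shows "finite {y. run \<delta> p w y q}"
proof (induction w arbitrary: p)
  case Nil
  have "{y. run \<delta> p [] y q} \<subseteq> {[]}" by (auto elim: run_nilE)
  then show ?case by (rule finite_subset) simp
next
  case (Cons a w)
  have "{y. run \<delta> p (a # w) y q} \<subseteq> (\<Union>(p', a', x, r)\<in>\<delta>. (@) x ` {y. run \<delta> r w y q})"
    by (fast elim: run_consE)
  moreover have "finite \<dots>"
    using assms Cons.IH by (intro finite_UN_I) auto
  ultimately show ?case by (rule finite_subset)
qed

section \<open>Transductions of rational languages\<close>

text \<open>Nonempty walks in a graph whose edges from \<open>p\<close> to \<open>q\<close> carry the words of \<open>M p q\<close>. Only the
  states passed through strictly between the two ends have to lie in \<open>S\<close>; this is what makes an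
  induction on \<open>S\<close> possible.\<close>

inductive walk :: "('q \<Rightarrow> 'q \<Rightarrow> 'b list set) \<Rightarrow> 'q set \<Rightarrow> 'q \<Rightarrow> 'q \<Rightarrow> 'b list \<Rightarrow> bool"
  for M S where
  one: "w \<in> M p q \<Longrightarrow> walk M S p q w"
| more: "w \<in> M p r \<Longrightarrow> r \<in> S \<Longrightarrow> walk M S r q v \<Longrightarrow> walk M S p q (w @ v)"

lemma walk_mono: "walk M S p q w \<Longrightarrow> S \<subseteq> S' \<Longrightarrow> walk M S' p q w"
  by (induction rule: walk.induct) (auto intro: walk.intros)

lemma walk_trans: "walk M S p r u \<Longrightarrow> r \<in> S \<Longrightarrow> walk M S r q v \<Longrightarrow> walk M S p q (u @ v)"
  by (induction rule: walk.induct) (auto intro: walk.intros)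

text \<open>Cutting a walk at its visits to \<open>k\<close> leaves pieces whose inner states avoid \<open>k\<close>.\<close>

lemma walk_insert:
  "walk M (insert k S) p q w \<longleftrightarrow> walk M S p q w \<or>
    (\<exists>u vs z. w = u @ concat vs @ z \<and> walk M S p k u \<and> vs \<in> lists {v. walk M S k k v} \<and> walk M S k q z)"
    (is "_ \<longleftrightarrow> _ \<or> ?loops p w")
proof
  assume "walk M (insert k S) p q w"
  then show "walk M S p q w \<or> ?loops p w"
  proof induction
    case (one w p q)
    then show ?case by (auto intro: walk.one)
  next
    case (more w p r q v)
    from more.IH show ?case
    proof
      assume v: "walk M S r q v"
      show ?thesis
      proof (cases "r = k")
        case True
        then show ?thesis using v more.hyps(1)
          by (intro disjI2 exI[of _ w] exI[of _ "[]"] exI[of _ v]) (auto intro: walk.one)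
      next
        case False
        then show ?thesis using v more.hyps by (auto intro: walk.more)
      qed
    next
      assume "\<exists>u vs z. v = u @ concat vs @ z \<and> walk M S r k u \<and>
        vs \<in> lists {v. walk M S k k v} \<and> walk M S k q z"
      then obtain u vs z where v: "v = u @ concat vs @ z" "walk M S r k u"
        "vs \<in> lists {v. walk M S k k v}" "walk M S k q z" by blast
      show ?thesis
      proof (cases "r = k")
        case True
        then show ?thesis using v more.hyps(1)
          by (intro disjI2 exI[of _ w] exI[of _ "u # vs"] exI[of _ z]) (auto intro: walk.one)
      next
        case False
        then show ?thesis using v more.hyps
          by (intro disjI2 exI[of _ "w @ u"] exI[of _ vs] exI[of _ z]) (auto intro: walk.more)
      qed
    qed
  qed
next
  have loops: "walk M (insert k S) k q (concat vs @ z)"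
    if "vs \<in> lists {v. walk M S k k v}" "walk M S k q z" for vs z
    using that
  proof (induction vs)
    case Nil
    then show ?case by (auto intro: walk_mono)
  next
    case (Cons v vs)
    then have "walk M (insert k S) k k v" "walk M (insert k S) k q (concat vs @ z)"
      by (auto intro: walk_mono)
    then show ?case using walk_trans[of M "insert k S" k k v q] by simp
  qed
  assume "walk M S p q w \<or> ?loops p w"
  then show "walk M (insert k S) p q w"
    using loops walk_mono[of M S _ _ _ "insert k S"] walk_trans[of M "insert k S" p k _ q]
    by (metis insertI1 subset_insertI)
qed

lemma rational_empty: "{} \<in> rational_languages \<Sigma>"
  by (rule rational_languages.finite) auto

lemma rational_finite_Union:
  "finite I \<Longrightarrow> (\<And>i. i \<in> I \<Longrightarrow> L i \<in> rational_languages \<Sigma>) \<Longrightarrow> (\<Union>i\<in>I. L i) \<in> rational_languages \<Sigma>"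
  by (induction rule: finite_induct) (auto intro: rational_empty rational_languages.union)

lemma rational_subset_lists: "L \<in> rational_languages \<Sigma> \<Longrightarrow> L \<subseteq> lists \<Sigma>"
proof (induction rule: rational_languages.induct)
  case (star L)
  have "concat ws \<in> lists \<Sigma>" if "ws \<in> lists L" for ws
    using that star.IH by (induction ws) auto
  then show ?case by blast
qed (auto, (meson in_lists_conv_set subset_iff)+)

text \<open>Kleene's theorem for graphs with rational edge labels. By the cutting lemma, allowing one more
  inner state \<open>k\<close> turns \<open>W p q\<close> into \<open>W p q \<union> W p k (W k k)\<^sup>* W k q\<close>.\<close>

lemma walk_rational:
  assumes "finite S" "\<And>p q. M p q \<in> rational_languages \<Sigma>"
  shows "{w. walk M S p q w} \<in> rational_languages \<Sigma>"
  using assms(1)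
proof (induction S arbitrary: p q)
  case empty
  have "{w. walk M {} p q w} = M p q"
    by (auto intro: walk.one elim: walk.cases)
  then show ?case using assms(2) by simp
next
  case (insert k S)
  let ?W = "\<lambda>p q. {w. walk M S p q w}"
  let ?star = "concat ` lists (?W k k)"
  let ?tail = "{u @ v | u v. u \<in> ?star \<and> v \<in> ?W k q}"
  have "{w. walk M (insert k S) p q w} = ?W p q \<union> {u @ v | u v. u \<in> ?W p k \<and> v \<in> ?tail}"
    unfolding walk_insert by blast
  also have "\<dots> \<in> rational_languages \<Sigma>"
    by (intro rational_languages.union rational_languages.product rational_languages.star insert.IH)
  finally show ?case .
qed

text \<open>In the product case the state reached between the two factors ranges over a finite set. A run
  on a word of \<open>L\<^sup>*\<close> is a walk through the states reached between its factors, with edges labelled by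
  the transductions of \<open>L\<close>, so that case is Kleene's theorem.\<close>

theorem transduction_rational:
  assumes L: "L \<in> rational_languages \<Sigma>" and fin: "finite \<delta>" and out: "outputs_over \<delta> \<Gamma>"
  shows "transduction \<delta> p q L \<in> rational_languages \<Gamma>"
  using L
proof (induction arbitrary: p q rule: rational_languages.induct)
  case (finite L)
  have "transduction \<delta> p q L = (\<Union>w\<in>L. {y. run \<delta> p w y q})"
    by (auto simp: transduction_def)
  moreover have "finite \<dots>" using finite finite_run_outputs[OF fin] by auto
  moreover have "transduction \<delta> p q L \<subseteq> lists \<Gamma>"
    using run_output[OF _ out] unfolding transduction_def by blast
  ultimately show ?case by (metis rational_languages.finite)
next
  case (union L M)
  have "transduction \<delta> p q (L \<union> M) = transduction \<delta> p q L \<union> transduction \<delta> p q M"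
    by (auto simp: transduction_def)
  then show ?case using union.IH by (simp add: rational_languages.union)
next
  case (product L M)
  have "transduction \<delta> p q {u @ v | u v. u \<in> L \<and> v \<in> M} =
    (\<Union>r\<in>insert p (states \<delta>).
      {x @ y | x y. x \<in> transduction \<delta> p r L \<and> y \<in> transduction \<delta> r q M})" (is "?l = ?r")
  proof
    show "?l \<subseteq> ?r"
    proof
      fix y assume "y \<in> ?l"
      then obtain u v where uv: "u \<in> L" "v \<in> M" "run \<delta> p (u @ v) y q"
        by (auto simp: transduction_def)
      then obtain y1 y2 r where "y = y1 @ y2" "run \<delta> p u y1 r" "run \<delta> r v y2 q"
        unfolding run_append by blast
      then show "y \<in> ?r" using uv run_end[of \<delta> p u y1 r] unfolding transduction_def by blast
    qed
    show "?r \<subseteq> ?l" using run_append[of \<delta> p] unfolding transduction_def by blast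
  qed
  also have "\<dots> \<in> rational_languages \<Gamma>"
    by (intro rational_finite_Union rational_languages.product product.IH) (use fin finite_states in auto)
  finally show ?case .
next
  case (star L)
  let ?M = "\<lambda>p q. transduction \<delta> p q L"
  let ?W = "\<lambda>p. {y. walk ?M (states \<delta> \<union> {p}) p q y}"
  have W: "walk ?M S p q y \<or> (p = q \<and> y = [])"
    if "ws \<in> lists L" "run \<delta> p (concat ws) y q" "insert p (states \<delta>) \<subseteq> S" for ws p y S
    using that
  proof (induction ws arbitrary: p y rule: list.induct)
    case Nil
    then show ?case by (auto elim: run_nilE)
  next
    case (Cons w ws)
    from Cons.prems(2) obtain y1 y2 r where
      y: "y = y1 @ y2" "run \<delta> p w y1 r" "run \<delta> r (concat ws) y2 q"
      by (auto simp: run_append)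
    have r: "r \<in> S" using run_end[OF y(2)] Cons.prems(3) by auto
    have "y1 \<in> ?M p r" using y(2) Cons.prems(1) by (auto simp: transduction_def)
    moreover have "walk ?M S r q y2 \<or> (r = q \<and> y2 = [])"
      using Cons.IH[OF _ y(3)] Cons.prems r by auto
    ultimately show ?case using y(1) r by (auto intro: walk.intros)
  qed
  have W': "\<exists>ws\<in>lists L. run \<delta> p (concat ws) y q" if "walk ?M S p q y" for p q y S
    using that
  proof induction
    case (one w p q)
    then obtain u where "u \<in> L" "run \<delta> p u w q" by (auto simp: transduction_def)
    then show ?case by (intro bexI[of _ "[u]"]) auto
  next
    case (more w p r q v)
    then obtain u ws where "u \<in> L" "run \<delta> p u w r" "ws \<in> lists L" "run \<delta> r (concat ws) v q"
      by (auto simp: transduction_def)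
    then show ?case by (intro bexI[of _ "u # ws"]) (auto simp: run_append)
  qed
  have "transduction \<delta> p q (concat ` lists L) = ?W p \<union> (if p = q then {[]} else {})" (is "?l = ?r")
  proof
    show "?l \<subseteq> ?r" using W[of _ p _ "states \<delta> \<union> {p}"] by (auto simp: transduction_def)
    show "?r \<subseteq> ?l"
    proof
      fix y assume "y \<in> ?r"
      then consider "walk ?M (states \<delta> \<union> {p}) p q y" | "p = q" "y = []"
        by (auto split: if_splits)
      then show "y \<in> ?l"
      proof cases
        case 1
        then show ?thesis using W' by (fastforce simp: transduction_def)
      next
        case 2
        then show ?thesis unfolding transduction_def
          by (auto intro!: bexI[of _ "[]"] image_eqI[of _ _ "[]"] run.nil)
      qed
    qed
  qed
  also have "\<dots> \<in> rational_languages \<Gamma>"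
    by (intro rational_languages.union walk_rational star.IH)
      (auto simp: fin finite_states intro: rational_empty rational_languages.finite)
  finally show ?case .
qed

section \<open>Transductions of context-free languages\<close>

text \<open>Derivation trees read from left to right. Inductions about the words of a grammar run over
  this relation, because \<^const>\<open>derives_step\<close> allows the nonterminals to be rewritten in any
  order.\<close>

inductive yields :: "('n \<times> ('n, 't) grammar_symbol list) set \<Rightarrow>
    ('n, 't) grammar_symbol list \<Rightarrow> 't list \<Rightarrow> bool" for P where
  nil: "yields P [] []"
| terminal: "yields P s w \<Longrightarrow> yields P (Terminal a # s) (a # w)"
| expand: "(A, \<gamma>) \<in> P \<Longrightarrow> yields P \<gamma> u \<Longrightarrow> yields P s v \<Longrightarrow> yields P (Nonterminal A # s) (u @ v)"

inductive_cases yields_nilE: "yields P [] w"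
inductive_cases yields_terminalE: "yields P (Terminal a # s) w"
inductive_cases yields_nonterminalE: "yields P (Nonterminal A # s) w"

lemma yields_terminals: "yields P (map Terminal x) w \<longleftrightarrow> w = x"
proof
  show "yields P (map Terminal x) w \<Longrightarrow> w = x"
    by (induction x arbitrary: w) (auto elim: yields_nilE yields_terminalE)
  have "yields P (map Terminal x) x"
    by (induction x) (auto intro: yields.intros)
  then show "w = x \<Longrightarrow> yields P (map Terminal x) w" by simp
qed

lemma yields_append:
  "yields P (s @ t) w \<longleftrightarrow> (\<exists>u v. w = u @ v \<and> yields P s u \<and> yields P t v)"
proof
  show "yields P (s @ t) w \<Longrightarrow> \<exists>u v. w = u @ v \<and> yields P s u \<and> yields P t v"
  proof (induction s arbitrary: w)
    case Nil
    then show ?case by (auto intro: yields.nil)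
  next
    case (Cons X s)
    show ?case
    proof (cases X)
      case (Terminal a)
      with Cons.prems obtain w' where "w = a # w'" "yields P (s @ t) w'"
        by (auto elim: yields_terminalE)
      then show ?thesis using Cons.IH Terminal by (metis append_Cons yields.terminal)
    next
      case (Nonterminal A)
      with Cons.prems obtain \<gamma> u w' where "w = u @ w'" "(A, \<gamma>) \<in> P" "yields P \<gamma> u" "yields P (s @ t) w'"
        by (auto elim: yields_nonterminalE)
      then show ?thesis using Cons.IH Nonterminal by (metis append.assoc yields.expand)
    qed
  qed
  have "yields P s u \<Longrightarrow> yields P t v \<Longrightarrow> yields P (s @ t) (u @ v)" for u v
    by (induction rule: yields.induct) (auto intro: yields.intros)
  then show "\<exists>u v. w = u @ v \<and> yields P s u \<and> yields P t v \<Longrightarrow> yields P (s @ t) w"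
    by blast
qed

lemma derives_append_context:
  "(derives_step P)\<^sup>*\<^sup>* s t \<Longrightarrow> (derives_step P)\<^sup>*\<^sup>* (\<alpha> @ s @ \<beta>) (\<alpha> @ t @ \<beta>)"
proof (induction rule: rtranclp_induct)
  case (step t u)
  from step.hyps(2) have "derives_step P (\<alpha> @ t @ \<beta>) (\<alpha> @ u @ \<beta>)"
  proof cases
    case (1 A \<gamma> \<alpha>' \<beta>')
    then show ?thesis using derives_step.intros[of A \<gamma> P "\<alpha> @ \<alpha>'" "\<beta>' @ \<beta>"] by simp
  qed
  then show ?case using step.IH by simp
qed simp

lemma yields_iff_derives: "yields P s w \<longleftrightarrow> (derives_step P)\<^sup>*\<^sup>* s (map Terminal w)"
proof
  show "yields P s w \<Longrightarrow> (derives_step P)\<^sup>*\<^sup>* s (map Terminal w)"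
  proof (induction rule: yields.induct)
    case (terminal s w a)
    then show ?case using derives_append_context[of P s _ "[Terminal a]" "[]"] by simp
  next
    case (expand A \<gamma> u s v)
    have "derives_step P (Nonterminal A # s) (\<gamma> @ s)"
      using derives_step.intros[OF expand.hyps(1), of "[]" s] by simp
    also have "(derives_step P)\<^sup>*\<^sup>* (\<gamma> @ s) (map Terminal u @ s)"
      using derives_append_context[OF expand.IH(1), of "[]" s] by simp
    also have "(derives_step P)\<^sup>*\<^sup>* (map Terminal u @ s) (map Terminal (u @ v))"
      using derives_append_context[OF expand.IH(2), of "map Terminal u" "[]"] by simp
    finally show ?case .
  qed simp
  show "(derives_step P)\<^sup>*\<^sup>* s (map Terminal w) \<Longrightarrow> yields P s w"
  proof (induction rule: converse_rtranclp_induct)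
    case base
    then show ?case by (simp add: yields_terminals)
  next
    case (step s t)
    from step.hyps(1) show ?case
    proof cases
      case (1 A \<gamma> \<alpha> \<beta>)
      then obtain u v x where "w = u @ v @ x" "yields P \<alpha> u" "yields P \<gamma> v" "yields P \<beta> x"
        using step.IH by (auto simp: yields_append)
      moreover have "yields P (Nonterminal A # \<beta>) (v @ x)"
        using 1(3) calculation by (intro yields.expand)
      ultimately show ?thesis unfolding 1(1) using yields_append[of P \<alpha>] by auto
    qed
  qed
qed

definition terminals_over :: "('n \<times> ('n, 't) grammar_symbol list) set \<Rightarrow> 't set \<Rightarrow> bool" where
  "terminals_over P \<Sigma> \<longleftrightarrow> (\<forall>(A, \<gamma>)\<in>P. \<forall>a. Terminal a \<in> set \<gamma> \<longrightarrow> a \<in> \<Sigma>)"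

lemma yields_lists:
  "yields P s w \<Longrightarrow> terminals_over P \<Sigma> \<Longrightarrow> (\<forall>a. Terminal a \<in> set s \<longrightarrow> a \<in> \<Sigma>) \<Longrightarrow> w \<in> lists \<Sigma>"
  by (induction rule: yields.induct) (auto simp: terminals_over_def)

lemma context_free_iff_yields:
  "L \<in> context_free_languages \<Sigma> \<longleftrightarrow>
    (\<exists>P S. finite P \<and> terminals_over P \<Sigma> \<and> L = {w. yields P [Nonterminal (S :: nat)] w})"
proof -
  have "{w \<in> lists \<Sigma>. (derives_step P)\<^sup>*\<^sup>* [Nonterminal S] (map Terminal w)} =
      {w. yields P [Nonterminal S] w}" if "terminals_over P \<Sigma>" for P and S :: nat
  proof -
    have "w \<in> lists \<Sigma>" if "yields P [Nonterminal S] w" for w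
      using yields_lists[OF that \<open>terminals_over P \<Sigma>\<close>] by simp
    then show ?thesis unfolding yields_iff_derives[symmetric] by blast
  qed
  then show ?thesis
    unfolding context_free_languages_def terminals_over_def[symmetric] by blast
qed

definition rename_productions ::
  "('n \<Rightarrow> 'm) \<Rightarrow> ('n \<times> ('n, 't) grammar_symbol list) set \<Rightarrow> ('m \<times> ('m, 't) grammar_symbol list) set" where
  "rename_productions f P = (\<lambda>(A, \<gamma>). (f A, map (map_grammar_symbol f id) \<gamma>)) ` P"

lemma yields_rename:
  "yields P s w \<Longrightarrow> yields (rename_productions f P) (map (map_grammar_symbol f id) s) w"
proof (induction rule: yields.induct)
  case (expand A \<gamma> u s v)
  then show ?case
    by (auto intro!: yields.expand simp: rename_productions_def intro: rev_image_eqI)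
qed (auto intro: yields.intros)

text \<open>The symbols that occur in a finite grammar can be numbered. Renaming along the numbering and
  back gives the original productions, so renaming in one direction proves both inclusions.\<close>

lemma context_free_any_nonterminals:
  fixes P :: "('n \<times> ('n, 't) grammar_symbol list) set"
  assumes fin: "finite P" and ter: "terminals_over P \<Sigma>"
  shows "{w. yields P [Nonterminal S] w} \<in> context_free_languages \<Sigma>"
proof -
  define V where "V = insert S (\<Union>(A, \<gamma>)\<in>P. insert A {B. Nonterminal B \<in> set \<gamma>})"
  have "finite {B. Nonterminal B \<in> set \<gamma>}" for \<gamma> :: "('n, 't) grammar_symbol list"
    using finite_vimageI[of "set \<gamma>" Nonterminal] by (simp add: vimage_def inj_def)
  then have "finite V" using fin by (auto simp: V_def)
  from finite_imp_inj_to_nat_seg[OF this] obtain f :: "'n \<Rightarrow> nat" where f: "inj_on f V"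
    by (elim exE conjE)
  define g where "g = inv_into V f"
  have g: "g (f A) = A" if "A \<in> V" for A using f that by (simp add: g_def)
  have sym: "map_grammar_symbol g id (map_grammar_symbol f id X) = X"
    if "X \<in> set \<gamma>" "(A, \<gamma>) \<in> P" for X A \<gamma>
  proof (cases X)
    case (Nonterminal B)
    then have "B \<in> V" using that by (auto simp: V_def)
    then show ?thesis using Nonterminal g by simp
  qed simp
  have "map (map_grammar_symbol g id) (map (map_grammar_symbol f id) \<gamma>) = \<gamma> \<and> g (f A) = A"
    if "(A, \<gamma>) \<in> P" for A \<gamma>
  proof
    show "map (map_grammar_symbol g id) (map (map_grammar_symbol f id) \<gamma>) = \<gamma>"
      using sym[OF _ that] by (simp add: map_idI)
    show "g (f A) = A" using that by (intro g) (force simp: V_def)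
  qed
  then have "(\<lambda>x. (case x of (A, \<gamma>) \<Rightarrow> (g A, map (map_grammar_symbol g id) \<gamma>)))
      ((\<lambda>(A, \<gamma>). (f A, map (map_grammar_symbol f id) \<gamma>)) x) = x" if "x \<in> P" for x
    using that by (cases x) auto
  then have inverse: "rename_productions g (rename_productions f P) = P"
    unfolding rename_productions_def image_image by simp
  have "yields P [Nonterminal S] w \<longleftrightarrow> yields (rename_productions f P) [Nonterminal (f S)] w" for w
    using yields_rename[of P "[Nonterminal S]" w f]
      yields_rename[of "rename_productions f P" "[Nonterminal (f S)]" w g] inverse g[of S]
    by (auto simp: V_def)
  moreover have "finite (rename_productions f P)" using fin by (simp add: rename_productions_def)
  moreover have "terminals_over (rename_productions f P) \<Sigma>"
  proof -
    have "Terminal a \<in> set \<gamma>" if "Terminal a = map_grammar_symbol f id X" "X \<in> set \<gamma>" for a X \<gamma>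
      using that by (cases X) auto
    then show ?thesis using ter unfolding terminals_over_def rename_productions_def by fastforce
  qed
  ultimately show ?thesis unfolding context_free_iff_yields by (intro exI conjI) auto
qed

text \<open>\<open>threads Q p s s' q\<close> guesses the states of a run from \<open>p\<close> to \<open>q\<close> over a word yielded by \<open>s\<close>: each
  symbol \<open>X\<close> of \<open>s\<close> becomes the triple of the state before \<open>X\<close>, \<open>X\<close> itself and the state after \<open>X\<close>.\<close>

inductive threads :: "'q set \<Rightarrow> 'q \<Rightarrow> ('n, 'a) grammar_symbol list \<Rightarrow>
    ('q \<times> ('n, 'a) grammar_symbol \<times> 'q, 'b) grammar_symbol list \<Rightarrow> 'q \<Rightarrow> bool" for Q where
  nil: "p \<in> Q \<Longrightarrow> threads Q p [] [] p"
| cons: "p \<in> Q \<Longrightarrow> threads Q q s s' r \<Longrightarrow> threads Q p (X # s) (Nonterminal (p, X, q) # s') r"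

inductive_cases threads_leftE: "threads Q p s [] q"
inductive_cases threads_consE: "threads Q p s (X # s') q"

lemma threads_states: "threads Q p s s' q \<Longrightarrow> p \<in> Q \<and> q \<in> Q"
  by (induction rule: threads.induct) auto

lemma threads_symbols:
  "threads Q p s s' q \<Longrightarrow> s' \<in> lists (Nonterminal ` (Q \<times> set s \<times> Q)) \<and> length s' = length s"
proof (induction rule: threads.induct)
  case (cons p q s s' r X)
  have "lists (Nonterminal ` (Q \<times> set s \<times> Q)) \<subseteq> lists (Nonterminal ` (Q \<times> set (X # s) \<times> Q))"
    by (intro lists_mono image_mono) auto
  then show ?case using cons threads_states[OF cons.hyps(2)] by auto
qed auto

text \<open>The Bar-Hillel grammar, extended to output. Terminals of the old grammar become nonterminals as
  well; the transitions of the transducer are the productions that replace them by output words.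
  Hence old and threaded sides of productions have the same length.\<close>

definition triple_productions ::
  "'q set \<Rightarrow> ('q \<times> 'a \<times> 'b list \<times> 'q) set \<Rightarrow> ('n \<times> ('n, 'a) grammar_symbol list) set \<Rightarrow>
    (('q \<times> ('n, 'a) grammar_symbol \<times> 'q) \<times>
      ('q \<times> ('n, 'a) grammar_symbol \<times> 'q, 'b) grammar_symbol list) set" where
  "triple_productions Q \<delta> P =
    (\<lambda>(p, a, x, q). ((p, Terminal a, q), map Terminal x)) ` \<delta> \<union>
    {((p, Nonterminal A, q), \<gamma>') | p A q \<gamma> \<gamma>'. (A, \<gamma>) \<in> P \<and> threads Q p \<gamma> \<gamma>' q}"

lemma finite_triple_productions:
  assumes "finite Q" "finite \<delta>" "finite P"
  shows "finite (triple_productions Q \<delta> P)"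
proof -
  have "{((p, Nonterminal A, q), \<gamma>') | p A q \<gamma> \<gamma>'. (A, \<gamma>) \<in> P \<and> threads Q p \<gamma> \<gamma>' q} \<subseteq>
    (\<Union>(A, \<gamma>)\<in>P. (Q \<times> {Nonterminal A} \<times> Q) \<times>
      {s. set s \<subseteq> Nonterminal ` (Q \<times> set \<gamma> \<times> Q) \<and> length s = length \<gamma>})"
    using threads_states threads_symbols by (fastforce simp: in_lists_conv_set)
  moreover have "finite \<dots>"
    using assms by (auto intro!: finite_cartesian_product finite_lists_length_eq)
  ultimately show ?thesis
    using assms(2) unfolding triple_productions_def by (auto dest: finite_subset)
qed

lemma run_yields_triple:
  assumes "states \<delta> \<subseteq> Q"
  shows "yields P s w \<Longrightarrow> run \<delta> p w y q \<Longrightarrow> p \<in> Q \<Longrightarrow>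
    \<exists>s'. threads Q p s s' q \<and> yields (triple_productions Q \<delta> P) s' y"
proof (induction arbitrary: p y q rule: yields.induct)
  case nil
  then show ?case by (auto elim!: run_nilE intro: threads.nil yields.nil)
next
  case (terminal s w a)
  then obtain x r y' where y: "y = x @ y'" "(p, a, x, r) \<in> \<delta>" "run \<delta> r w y' q"
    by (auto elim: run_consE)
  moreover have "r \<in> Q" using y(2) assms transition_in_states by fastforce
  ultimately obtain s' where s': "threads Q r s s' q" "yields (triple_productions Q \<delta> P) s' y'"
    using terminal.IH by blast
  have "((p, Terminal a, r), map Terminal x) \<in> triple_productions Q \<delta> P"
    using y(2) by (force simp: triple_productions_def)
  then have "yields (triple_productions Q \<delta> P) (Nonterminal (p, Terminal a, r) # s') y"
    unfolding y(1) by (rule yields.expand) (simp_all add: yields_terminals s')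
  then show ?case using threads.cons[OF terminal.prems(2) s'(1)] by blast
next
  case (expand A \<gamma> u s v)
  then obtain y1 y2 r where y: "y = y1 @ y2" "run \<delta> p u y1 r" "run \<delta> r v y2 q"
    by (auto simp: run_append)
  have "r \<in> Q" using run_end[OF y(2)] assms expand.prems(2) by auto
  then obtain s' where s': "threads Q r s s' q" "yields (triple_productions Q \<delta> P) s' y2"
    using expand.IH(2) y(3) by blast
  obtain \<gamma>' where \<gamma>': "threads Q p \<gamma> \<gamma>' r" "yields (triple_productions Q \<delta> P) \<gamma>' y1"
    using expand.IH(1) y(2) expand.prems(2) by blast
  have "((p, Nonterminal A, r), \<gamma>') \<in> triple_productions Q \<delta> P"
    using expand.hyps(1) \<gamma>'(1) by (auto simp: triple_productions_def)
  then have "yields (triple_productions Q \<delta> P) (Nonterminal (p, Nonterminal A, r) # s') y"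
    unfolding y(1) by (rule yields.expand) (simp_all add: \<gamma>' s')
  then show ?case using threads.cons[OF expand.prems(2) s'(1)] by blast
qed

lemma yields_triple_run:
  "yields (triple_productions Q \<delta> P) s' y \<Longrightarrow> threads Q p s s' q \<Longrightarrow>
    \<exists>w. yields P s w \<and> run \<delta> p w y q"
proof (induction arbitrary: p s q rule: yields.induct)
  case nil
  then show ?case by (auto elim!: threads_leftE intro: yields.nil run.nil)
next
  case (terminal s w a)
  then show ?case by (auto elim: threads_consE)
next
  case (expand B \<gamma>' y1 s' y2)
  then obtain X r s0 where s: "s = X # s0" "B = (p, X, r)" "threads Q r s0 s' q"
    by (auto elim: threads_consE)
  then obtain v where v: "yields P s0 v" "run \<delta> r v y2 q"
    using expand.IH(2) by blast
  from expand.hyps(1) consider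
      (letter) a x where "(p, a, x, r) \<in> \<delta>" "X = Terminal a" "\<gamma>' = map Terminal x"
    | (production) A \<gamma> where "X = Nonterminal A" "(A, \<gamma>) \<in> P" "threads Q p \<gamma> \<gamma>' r"
    unfolding triple_productions_def s(2) by auto
  then show ?case
  proof cases
    case letter
    then have "y1 = x" using expand.hyps(2) by (simp add: yields_terminals)
    then show ?thesis using letter v s(1) by (auto intro: yields.terminal run.step)
  next
    case production
    then obtain u where "yields P \<gamma> u" "run \<delta> p u y1 r"
      using expand.IH(1) by blast
    then show ?thesis
      using production v s(1) run_append_intro[of \<delta> p u y1 r v y2 q]
      by (auto intro!: exI[of _ "u @ v"] intro: yields.expand)
  qed
qed

text \<open>The triple \<open>(p, X, q)\<close> yields the outputs of the runs from \<open>p\<close> to \<open>q\<close> on the words yielded by \<open>X\<close>.\<close>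

theorem transduction_context_free:
  assumes L: "L \<in> context_free_languages \<Sigma>" and fin: "finite \<delta>" and out: "outputs_over \<delta> \<Gamma>"
  shows "transduction \<delta> p q L \<in> context_free_languages \<Gamma>"
proof -
  obtain P S where P: "finite P" "L = {w. yields P [Nonterminal (S :: nat)] w}"
    using L unfolding context_free_iff_yields by blast
  define Q where "Q = {p, q} \<union> states \<delta>"
  let ?P = "triple_productions Q \<delta> P"
  have "terminals_over ?P \<Gamma>"
    unfolding terminals_over_def
  proof safe
    fix B \<gamma> a assume "(B, \<gamma>) \<in> ?P" "Terminal a \<in> set \<gamma>"
    then show "a \<in> \<Gamma>"
      unfolding triple_productions_def using out
      by (fastforce simp: outputs_over_def dest: threads_symbols)
  qed
  moreover have "finite ?P"
    using finite_triple_productions[OF _ fin P(1)] finite_states[OF fin] by (auto simp: Q_def)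
  ultimately have "{y. yields ?P [Nonterminal (p, Nonterminal S, q)] y} \<in> context_free_languages \<Gamma>"
    by (intro context_free_any_nonterminals)
  moreover have "transduction \<delta> p q L = {y. yields ?P [Nonterminal (p, Nonterminal S, q)] y}"
    (is "?l = ?r")
  proof
    show "?l \<subseteq> ?r"
    proof
      fix y assume "y \<in> ?l"
      then obtain w where w: "yields P [Nonterminal S] w" "run \<delta> p w y q"
        by (auto simp: transduction_def P)
      then obtain s' where "threads Q p [Nonterminal S] s' q" "yields ?P s' y"
        using run_yields_triple[OF _ w, of Q] unfolding Q_def by blast
      then show "y \<in> ?r" by (auto elim!: threads.cases[of _ _ "[_]"] threads.cases[of _ _ "[]"])
    qed
    show "?r \<subseteq> ?l"
    proof
      fix y assume "y \<in> ?r"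
      moreover have "threads Q p [Nonterminal S] [Nonterminal (p, Nonterminal S, q)] q"
        by (intro threads.intros) (auto simp: Q_def)
      ultimately show "y \<in> ?l"
        using yields_triple_run unfolding transduction_def P by fastforce
    qed
  qed
  ultimately show ?thesis by simp
qed

section \<open>Inverse homomorphisms as transductions\<close>

text \<open>The transducer guesses the word \<open>y\<close> while it reads \<open>v @ concat (map h y)\<close>. Its state is what
  remains to be read of \<open>v\<close> or of the image of the current letter; a guessed letter \<open>b\<close> is written
  when the first letter of \<open>h b\<close> is read. This is why no \<open>h b\<close> may be empty.\<close>

lemma nonerasing_inverse_transducer:
  fixes h :: "'b \<Rightarrow> 'a list"
  assumes fin: "finite \<Gamma>" and ne: "\<And>b. b \<in> \<Gamma> \<Longrightarrow> h b \<noteq> []"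
  shows "\<exists>\<delta>. finite \<delta> \<and> outputs_over \<delta> \<Gamma> \<and>
    (\<forall>L. transduction \<delta> v [] L = {y \<in> lists \<Gamma>. v @ concat (map h y) \<in> L})"
proof -
  define R where "R = (\<Union>z\<in>insert v (h ` \<Gamma>). (\<lambda>i. drop i z) ` {..length z})"
  have R_tl: "r \<in> R" if "c # r \<in> R" for c r
  proof -
    from that obtain z i where z: "z \<in> insert v (h ` \<Gamma>)" "i \<le> length z" "c # r = drop i z"
      unfolding R_def by auto
    have "i < length z" using z(2,3) by (cases "i = length z") auto
    moreover have "r = drop (Suc i) z" using z(3) by (metis drop_Suc list.sel(3) tl_drop)
    ultimately show ?thesis unfolding R_def using z(1) by fastforce
  qed
  have "z \<in> R" if "z \<in> insert v (h ` \<Gamma>)" for z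
    unfolding R_def using that by (intro UN_I[of z]) (auto intro: image_eqI[of _ _ 0])
  then have v: "v \<in> R" and R_h: "\<And>b. b \<in> \<Gamma> \<Longrightarrow> h b \<in> R" by auto
  define read where "read = (\<lambda>z. (z, hd z, [] :: 'b list, tl z)) ` (R - {[]})"
  define emit where "emit = (\<lambda>b. ([] :: 'a list, hd (h b), [b], tl (h b))) ` \<Gamma>"
  let ?\<delta> = "read \<union> emit"
  have "finite ?\<delta>" using fin by (auto simp: read_def emit_def R_def)
  moreover have out: "outputs_over ?\<delta> \<Gamma>" by (auto simp: outputs_over_def read_def emit_def)
  moreover have "transduction ?\<delta> v [] L = {y \<in> lists \<Gamma>. v @ concat (map h y) \<in> L}" for L
  proof -
    have sound: "w = r @ concat (map h y)" if "run ?\<delta> r w y q" "q = []" for r w y q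
      using that
    proof (induction rule: run.induct)
      case (step p a x q w y r)
      then show ?case using ne by (cases p) (auto simp: read_def emit_def)
    qed simp
    have reading: "run ?\<delta> r r [] []" if "r \<in> R" for r
      using that
    proof (induction r)
      case Nil
      show ?case by (rule run.nil)
    next
      case (Cons c r)
      have "(c # r, c, [], r) \<in> ?\<delta>" using Cons.prems by (force simp: read_def)
      from run.step[OF this Cons.IH[OF R_tl[OF Cons.prems]]] show ?case by simp
    qed
    have letter: "run ?\<delta> [] (h b) [b] []" if "b \<in> \<Gamma>" for b
    proof -
      have hb: "h b = hd (h b) # tl (h b)" using ne[OF that] by simp
      have "([], hd (h b), [b], tl (h b)) \<in> ?\<delta>" using that by (auto simp: emit_def)
      moreover have "tl (h b) \<in> R" using R_tl[of "hd (h b)"] R_h[OF that] hb by simp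
      ultimately show ?thesis using run.step[OF _ reading, of "[]" "hd (h b)" "[b]" "tl (h b)"] hb by simp
    qed
    have "run ?\<delta> [] (concat (map h y)) y []" if "y \<in> lists \<Gamma>" for y
      using that
    proof (induction y)
      case Nil
      show ?case by (simp add: run.nil)
    next
      case (Cons b y)
      then show ?case using run_append_intro[OF letter[of b] Cons.IH] by simp
    qed
    then have complete: "run ?\<delta> v (v @ concat (map h y)) y []" if "y \<in> lists \<Gamma>" for y
      using run_append_intro[OF reading[OF v]] that append_Nil by metis
    show ?thesis
    proof (intro equalityI subsetI)
      fix y assume "y \<in> transduction ?\<delta> v [] L"
      then obtain w where w: "w \<in> L" "run ?\<delta> v w y []" unfolding transduction_def by blast
      then show "y \<in> {y \<in> lists \<Gamma>. v @ concat (map h y) \<in> L}"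
        using sound[OF w(2) HOL.refl] run_output[OF w(2) out] by simp
    next
      fix y assume "y \<in> {y \<in> lists \<Gamma>. v @ concat (map h y) \<in> L}"
      then show "y \<in> transduction ?\<delta> v [] L"
        using complete[of y] unfolding transduction_def by blast
    qed
  qed
  ultimately show ?thesis by (intro exI[of _ ?\<delta>] conjI allI)
qed


section \<open>Finite index subgroups\<close>

lemma (in group) inv_mult_cancel [simp]:
  assumes "x \<in> carrier G" "y \<in> carrier G"
  shows "inv x \<otimes> (x \<otimes> y) = y" and "x \<otimes> (inv x \<otimes> y) = y"
  using assms by (simp_all add: m_assoc[symmetric])

lemma (in group) mem_r_coset_iff:
  assumes "subgroup H G" "x \<in> carrier G" "y \<in> carrier G"
  shows "x \<in> H #> y \<longleftrightarrow> x \<otimes> inv y \<in> H"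
proof -
  interpret H: subgroup H G by fact
  have "x = (x \<otimes> inv y) \<otimes> y" using assms by (simp add: m_assoc)
  moreover have "(h \<otimes> y) \<otimes> inv y = h" if "h \<in> H" for h
    using that assms H.mem_carrier by (simp add: m_assoc)
  ultimately show ?thesis by (auto simp: r_coset_def)
qed

lemma (in group) r_coset_eq_iff:
  assumes "subgroup H G" "x \<in> carrier G" "y \<in> carrier G"
  shows "H #> x = H #> y \<longleftrightarrow> x \<otimes> inv y \<in> H"
proof -
  have "H #> x = H #> y \<longleftrightarrow> x \<in> H #> y"
    using assms repr_independence[of x H y] rcos_self[of x H] by blast
  then show ?thesis using mem_r_coset_iff[OF assms] by simp
qed

text \<open>Representatives can be chosen inside any subset \<open>S\<close>. With \<open>S\<close> a subgroup this says that \<open>H \<inter> S\<close>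
  has finite index in \<open>S\<close>.\<close>

lemma (in group) finite_representatives:
  assumes H: "finite_index_subgroup H G" and S: "S \<subseteq> carrier G"
  obtains T where "finite T" "T \<subseteq> S" "\<And>x. x \<in> S \<Longrightarrow> \<exists>t\<in>T. x \<otimes> inv t \<in> H"
proof -
  have sub: "subgroup H G" using H by (simp add: finite_index_subgroup_def)
  have "(\<lambda>x. H #> x) ` S \<subseteq> rcosets H" using S by (auto simp: RCOSETS_def)
  then have "finite ((\<lambda>x. H #> x) ` S)"
    using H finite_subset unfolding finite_index_subgroup_def by blast
  from finite_subset_image[OF this subset_refl] obtain T where
    T: "T \<subseteq> S" "finite T" "(\<lambda>x. H #> x) ` S = (\<lambda>x. H #> x) ` T" by blast
  have "\<exists>t\<in>T. x \<otimes> inv t \<in> H" if "x \<in> S" for x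
  proof -
    have "H #> x \<in> (\<lambda>x. H #> x) ` T" unfolding T(3)[symmetric] using that by (rule imageI)
    then obtain t where "t \<in> T" "H #> x = H #> t" by blast
    then show ?thesis using r_coset_eq_iff[OF sub, of x t] that T(1) S by blast
  qed
  then show ?thesis using that T by blast
qed

lemma (in group) finite_index_subgroupI:
  assumes "subgroup H G" "finite T" "T \<subseteq> carrier G"
    "\<And>x. x \<in> carrier G \<Longrightarrow> \<exists>t\<in>T. x \<otimes> inv t \<in> H"
  shows "finite_index_subgroup H G"
proof -
  have "rcosets H \<subseteq> (\<lambda>t. H #> t) ` T"
  proof
    fix C assume "C \<in> rcosets H"
    then obtain x where x: "x \<in> carrier G" "C = H #> x" by (auto simp: RCOSETS_def)
    then obtain t where t: "t \<in> T" "x \<otimes> inv t \<in> H" using assms(4) by blast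
    then have "C = H #> t" using x assms(3) r_coset_eq_iff[OF assms(1), of x t] by blast
    then show "C \<in> (\<lambda>t. H #> t) ` T" using t by blast
  qed
  then show ?thesis
    using assms(1,2) by (auto simp: finite_index_subgroup_def intro: finite_subset)
qed

lemma (in group) finite_index_trans:
  assumes N: "finite_index_subgroup N G" and U: "finite_index_subgroup U (G\<lparr>carrier := N\<rparr>)"
  shows "finite_index_subgroup U G"
proof -
  have subN: "subgroup N G" using N by (simp add: finite_index_subgroup_def)
  interpret N: group "G\<lparr>carrier := N\<rparr>" using subN by (rule subgroup_imp_group)
  have NG: "N \<subseteq> carrier G" using subN by (rule subgroup.subset)
  have subU: "subgroup U G"
    using U incl_subgroup[OF subN] by (simp add: finite_index_subgroup_def)
  obtain T where T: "finite T" "T \<subseteq> carrier G" "\<And>x. x \<in> carrier G \<Longrightarrow> \<exists>t\<in>T. x \<otimes> inv t \<in> N"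
    using finite_representatives[OF N subset_refl] by blast
  obtain R where R: "finite R" "R \<subseteq> N" "\<And>x. x \<in> N \<Longrightarrow> \<exists>t\<in>R. x \<otimes> inv\<^bsub>G\<lparr>carrier := N\<rparr>\<^esub> t \<in> U"
    using N.finite_representatives[OF U, of N] by auto
  show ?thesis
  proof (rule finite_index_subgroupI[OF subU])
    let ?P = "(\<lambda>(r, t). r \<otimes> t) ` (R \<times> T)"
    show "finite ?P" using T R by simp
    show "?P \<subseteq> carrier G" using T(2) R(2) NG by auto
    fix x assume x: "x \<in> carrier G"
    obtain t where t: "t \<in> T" "x \<otimes> inv t \<in> N" using T(3) x by blast
    obtain r where r: "r \<in> R" "(x \<otimes> inv t) \<otimes> inv\<^bsub>G\<lparr>carrier := N\<rparr>\<^esub> r \<in> U" using R(3) t(2) by blast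
    have "r \<in> N" "r \<in> carrier G" "t \<in> carrier G" using r t T R NG by auto
    then have "x \<otimes> inv (r \<otimes> t) = (x \<otimes> inv t) \<otimes> inv\<^bsub>G\<lparr>carrier := N\<rparr>\<^esub> r"
      using x subN by (simp add: inv_mult_group m_assoc)
    then show "\<exists>s\<in>?P. x \<otimes> inv s \<in> U" using r t by force
  qed
qed

lemma (in group) finite_index_restrict:
  assumes N: "finite_index_subgroup N G" and U: "subgroup U G" "N \<subseteq> U"
  shows "finite_index_subgroup N (G\<lparr>carrier := U\<rparr>)"
proof -
  interpret U: group "G\<lparr>carrier := U\<rparr>" using U(1) by (rule subgroup_imp_group)
  have subN: "subgroup N G" using N by (simp add: finite_index_subgroup_def)
  obtain T where T: "finite T" "T \<subseteq> U" "\<And>x. x \<in> U \<Longrightarrow> \<exists>t\<in>T. x \<otimes> inv t \<in> N"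
    using finite_representatives[OF N subgroup.subset[OF U(1)]] by blast
  show ?thesis
  proof (rule U.finite_index_subgroupI[of N T])
    show "subgroup N (G\<lparr>carrier := U\<rparr>)" using subgroup_incl[OF subN U] .
    show "\<exists>t\<in>T. x \<otimes>\<^bsub>G\<lparr>carrier := U\<rparr>\<^esub> inv\<^bsub>G\<lparr>carrier := U\<rparr>\<^esub> t \<in> N"
      if "x \<in> carrier (G\<lparr>carrier := U\<rparr>)" for x
      using T(3)[of x] that T(2) U(1) by force
  qed (use T in auto)
qed

text \<open>The kernel of the action of the group on the finitely many cosets of \<open>U\<close>.\<close>

lemma (in group) finite_index_normal_core:
  assumes U: "finite_index_subgroup U G"
  obtains N where "N \<lhd> G" "finite_index_subgroup N G" "N \<subseteq> U"
proof -
  have subU: "subgroup U G" and finU: "finite (rcosets U)"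
    using U by (simp_all add: finite_index_subgroup_def)
  define act where "act g = (\<lambda>C\<in>rcosets U. C #> g)" for g
  define N where "N = {n \<in> carrier G. act n = act \<one>}"
  have coset: "C \<subseteq> carrier G" "C #> g \<in> rcosets U" if "C \<in> rcosets U" "g \<in> carrier G" for C g
  proof -
    show "C \<subseteq> carrier G" using that subU rcosets_part_G by blast
    show "C #> g \<in> rcosets U"
      using that subgroup.subset[OF subU] by (auto simp: RCOSETS_def coset_mult_assoc)
  qed
  have act_iff: "act g = act h \<longleftrightarrow> (\<forall>C\<in>rcosets U. C #> g = C #> h)" for g h
    by (auto simp: act_def fun_eq_iff restrict_def)
  have act_mult: "act (g \<otimes> h) = act (g' \<otimes> h')"
    if "act g = act g'" "act h = act h'" "g \<in> carrier G" "h \<in> carrier G" "g' \<in> carrier G" "h' \<in> carrier G"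
    for g h g' h'
    using that coset unfolding act_iff by (metis coset_mult_assoc)
  have act_inv: "act (g \<otimes> inv h) = act \<one>" if "act g = act h" "g \<in> carrier G" "h \<in> carrier G" for g h
    using act_mult[OF that(1) HOL.refl, of "inv h"] that by simp
  have subN: "subgroup N G"
  proof (rule subgroupI)
    show "inv a \<in> N" if "a \<in> N" for a
      using act_inv[of \<one> a] that unfolding N_def by simp
    show "a \<otimes> b \<in> N" if "a \<in> N" "b \<in> N" for a b
      using act_mult[of a \<one> b \<one>] that unfolding N_def by simp
  qed (auto simp: N_def)
  have "x \<otimes> n \<otimes> inv x \<in> N" if "x \<in> carrier G" "n \<in> N" for x n
  proof -
    have "act (x \<otimes> n) = act x"
      using act_mult[of x x n \<one>] that unfolding N_def by simp
    then show ?thesis using act_inv that unfolding N_def by simp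
  qed
  then have normal: "N \<lhd> G" using subN normal_inv_iff by blast
  have "N \<subseteq> U"
  proof
    fix n assume n: "n \<in> N"
    have "U \<in> rcosets U" using subgroup.subgroup_in_rcosets[OF subU is_group] .
    then have "U #> n = U #> \<one>" using n act_iff unfolding N_def by blast
    then show "n \<in> U" using r_coset_eq_iff[OF subU, of n \<one>] n by (simp add: N_def)
  qed
  have "act ` carrier G \<subseteq> rcosets U \<rightarrow>\<^sub>E rcosets U"
    using coset by (auto simp: act_def)
  then have "finite (act ` carrier G)" by (rule finite_subset) (intro finite_PiE finU)
  from finite_subset_image[OF this subset_refl] obtain T where
    T: "T \<subseteq> carrier G" "finite T" "act ` carrier G = act ` T" by blast
  have "finite_index_subgroup N G"
  proof (rule finite_index_subgroupI[OF subN T(2,1)])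
    fix x assume x: "x \<in> carrier G"
    then obtain t where t: "t \<in> T" "act x = act t" using T(3) by auto
    then show "\<exists>t\<in>T. x \<otimes> inv t \<in> N" using act_inv x T(1) unfolding N_def by blast
  qed
  then show ?thesis using that normal \<open>N \<subseteq> U\<close> by blast
qed

section \<open>The profinite topology\<close>

lemma (in group) conjugate_subgroup:
  assumes "subgroup H G" "a \<in> carrier G"
  shows "subgroup {x \<in> carrier G. a \<otimes> x \<otimes> inv a \<in> H} G"
proof -
  interpret H: subgroup H G by fact
  have split: "a \<otimes> (x \<otimes> y) \<otimes> inv a = (a \<otimes> x \<otimes> inv a) \<otimes> (a \<otimes> y \<otimes> inv a)"
    and inverse: "a \<otimes> inv x \<otimes> inv a = inv (a \<otimes> x \<otimes> inv a)"
    if "x \<in> carrier G" "y \<in> carrier G" for x y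
    using that assms(2) by (simp_all add: m_assoc inv_mult_group)
  show ?thesis
  proof (rule subgroupI)
    have "\<one> \<in> {x \<in> carrier G. a \<otimes> x \<otimes> inv a \<in> H}" using assms(2) by simp
    then show "{x \<in> carrier G. a \<otimes> x \<otimes> inv a \<in> H} \<noteq> {}" by auto
    show "inv x \<in> {x \<in> carrier G. a \<otimes> x \<otimes> inv a \<in> H}"
      if "x \<in> {x \<in> carrier G. a \<otimes> x \<otimes> inv a \<in> H}" for x
      using that inverse[of x x] by simp
    show "x \<otimes> y \<in> {x \<in> carrier G. a \<otimes> x \<otimes> inv a \<in> H}"
      if "x \<in> {x \<in> carrier G. a \<otimes> x \<otimes> inv a \<in> H}"
        "y \<in> {x \<in> carrier G. a \<otimes> x \<otimes> inv a \<in> H}" for x y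
      using that split[of x y] by simp
  qed blast
qed

lemma (in group) conjugate_finite_index:
  assumes H: "finite_index_subgroup H G" and a: "a \<in> carrier G"
  shows "finite_index_subgroup {x \<in> carrier G. a \<otimes> x \<otimes> inv a \<in> H} G"
proof -
  obtain T where T: "finite T" "T \<subseteq> carrier G" "\<And>x. x \<in> carrier G \<Longrightarrow> \<exists>t\<in>T. x \<otimes> inv t \<in> H"
    using finite_representatives[OF H subset_refl] by blast
  show ?thesis
  proof (rule finite_index_subgroupI[of _ "(\<lambda>t. inv a \<otimes> t \<otimes> a) ` T"])
    show "subgroup {x \<in> carrier G. a \<otimes> x \<otimes> inv a \<in> H} G"
      using H a conjugate_subgroup by (simp add: finite_index_subgroup_def)
    fix x assume x: "x \<in> carrier G"
    obtain t where t: "t \<in> T" "(a \<otimes> x \<otimes> inv a) \<otimes> inv t \<in> H" using T(3) x a by blast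
    have "t \<in> carrier G" using t T by blast
    then have "a \<otimes> (x \<otimes> inv (inv a \<otimes> t \<otimes> a)) \<otimes> inv a = (a \<otimes> x \<otimes> inv a) \<otimes> inv t"
      using x a by (simp add: m_assoc inv_mult_group)
    then show "\<exists>s\<in>(\<lambda>t. inv a \<otimes> t \<otimes> a) ` T. x \<otimes> inv s \<in> {x \<in> carrier G. a \<otimes> x \<otimes> inv a \<in> H}"
      using t x a \<open>t \<in> carrier G\<close> by (intro bexI[of _ "inv a \<otimes> t \<otimes> a"]) auto
  qed (use T a in auto)
qed

lemma (in group) topspace_profinite: "topspace (profinite_topology G) = carrier G"
proof -
  have "finite_index_subgroup (carrier G) G"
    by (rule finite_index_subgroupI[of _ "{\<one>}"]) (auto simp: subgroup_self)
  moreover have "carrier G \<in> rcosets carrier G"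
    using subgroup.subgroup_in_rcosets[OF subgroup_self is_group] .
  moreover have "C \<subseteq> carrier G" if "finite_index_subgroup H G" "C \<in> rcosets H" for H C
    using that rcosets_part_G unfolding finite_index_subgroup_def by blast
  ultimately show ?thesis
    unfolding profinite_topology_def topology_generated_by_topspace by blast
qed

lemma openin_profinite_coset:
  "finite_index_subgroup H G \<Longrightarrow> C \<in> rcosets\<^bsub>G\<^esub> H \<Longrightarrow> openin (profinite_topology G) C"
  unfolding profinite_topology_def by (intro topology_generated_by_Basis) blast

text \<open>The preimage of a coset of \<open>H\<close> is a coset of a conjugate of \<open>H\<close>, which has finite index too.\<close>

lemma (in group) continuous_translation:
  assumes a: "a \<in> carrier G" and b: "b \<in> carrier G"
  shows "continuous_map (profinite_topology G) (profinite_topology G) (\<lambda>x. a \<otimes> x \<otimes> b)"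
  unfolding profinite_topology_def[of G] continuous_on_generated_topo_iff
  unfolding profinite_topology_def[symmetric] topspace_profinite
proof (intro conjI ballI allI impI)
  show "(\<lambda>x. a \<otimes> x \<otimes> b) ` carrier G \<subseteq> \<Union> (\<Union>H\<in>{H. finite_index_subgroup H G}. rcosets H)"
    using a b topspace_profinite
    unfolding profinite_topology_def topology_generated_by_topspace by auto
next
  fix C assume "C \<in> (\<Union>H\<in>{H. finite_index_subgroup H G}. rcosets H)"
  then obtain H y where H: "finite_index_subgroup H G" and y: "y \<in> carrier G" and C: "C = H #> y"
    by (auto simp: RCOSETS_def)
  have subH: "subgroup H G" using H by (simp add: finite_index_subgroup_def)
  define H' where "H' = {x \<in> carrier G. a \<otimes> x \<otimes> inv a \<in> H}"
  have H': "finite_index_subgroup H' G" "subgroup H' G"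
    unfolding H'_def using conjugate_finite_index[OF H a] conjugate_subgroup[OF subH a] by auto
  define z where "z = inv a \<otimes> y \<otimes> inv b"
  have z: "z \<in> carrier G" using a b y by (simp add: z_def)
  have "(\<lambda>x. a \<otimes> x \<otimes> b) -` C \<inter> carrier G = H' #> z"
  proof -
    have "a \<otimes> x \<otimes> b \<in> C \<longleftrightarrow> x \<in> H' #> z" if x: "x \<in> carrier G" for x
    proof -
      have "a \<otimes> (x \<otimes> inv z) \<otimes> inv a = (a \<otimes> x \<otimes> b) \<otimes> inv y"
        using a b x y by (simp add: z_def m_assoc inv_mult_group)
      then show ?thesis
        using mem_r_coset_iff[OF subH, of "a \<otimes> x \<otimes> b" y] mem_r_coset_iff[OF H'(2) x z] a b x y z
        by (simp add: C H'_def)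
    qed
    moreover have "H' #> z \<subseteq> carrier G"
      using r_coset_subset_G[OF subgroup.subset[OF H'(2)] z] .
    ultimately show ?thesis by blast
  qed
  moreover have "H' #> z \<in> rcosets H'" using z by (auto simp: RCOSETS_def)
  ultimately show "openin (profinite_topology G) ((\<lambda>x. a \<otimes> x \<otimes> b) -` C \<inter> carrier G)"
    using openin_profinite_coset[OF H'(1)] by simp
qed

lemma (in group) separable_translate:
  assumes X: "separable G X" and a: "a \<in> carrier G" and b: "b \<in> carrier G"
  shows "separable G ((\<lambda>x. a \<otimes> x \<otimes> b) ` X)"
proof -
  have XG: "X \<subseteq> carrier G"
    using X closedin_subset topspace_profinite unfolding separable_def by fastforce
  have "(\<lambda>x. a \<otimes> x \<otimes> b) ` X = {x \<in> carrier G. inv a \<otimes> x \<otimes> inv b \<in> X}"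
  proof (intro equalityI subsetI)
    fix y assume "y \<in> (\<lambda>x. a \<otimes> x \<otimes> b) ` X"
    then show "y \<in> {x \<in> carrier G. inv a \<otimes> x \<otimes> inv b \<in> X}"
      using XG a b by (auto simp: m_assoc subset_iff)
  next
    fix y assume y: "y \<in> {x \<in> carrier G. inv a \<otimes> x \<otimes> inv b \<in> X}"
    then have "y = a \<otimes> (inv a \<otimes> y \<otimes> inv b) \<otimes> b"
      using a b by (simp add: m_assoc)
    then show "y \<in> (\<lambda>x. a \<otimes> x \<otimes> b) ` X" using y by blast
  qed
  then show ?thesis
    using closedin_continuous_map_preimage[OF continuous_translation[of "inv a" "inv b"], of X]
      X a b topspace_profinite by (simp add: separable_def)
qed

lemma (in group) openin_finite_index_subgroup:
  assumes N: "finite_index_subgroup N G" and X: "openin (profinite_topology (G\<lparr>carrier := N\<rparr>)) X"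
  shows "openin (profinite_topology G) X"
proof -
  have subN: "subgroup N G" using N by (simp add: finite_index_subgroup_def)
  have "generate_topology_on (\<Union>H\<in>{H. finite_index_subgroup H (G\<lparr>carrier := N\<rparr>)}.
      rcosets\<^bsub>G\<lparr>carrier := N\<rparr>\<^esub> H) X"
    using X unfolding profinite_topology_def by (rule openin_topology_generated_by)
  then show ?thesis
  proof induction
    case (Basis C)
    then obtain H x where H: "finite_index_subgroup H (G\<lparr>carrier := N\<rparr>)" "x \<in> N" "C = H #> x"
      by (auto simp: RCOSETS_def)
    have "C \<in> rcosets H"
      using H subgroup.subset[OF subN] by (auto simp: RCOSETS_def)
    then show ?case using finite_index_trans[OF N H(1)] openin_profinite_coset by blast
  qed auto
qed

text \<open>The finite index subgroups of \<open>N\<close> have finite index in \<open>G\<close>, so sets open in \<open>N\<close> are open in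
  \<open>G\<close>; and the complement of \<open>N\<close> is a union of cosets of \<open>N\<close>.\<close>

lemma (in group) separable_finite_index_subgroup:
  assumes N: "finite_index_subgroup N G" and X: "separable (G\<lparr>carrier := N\<rparr>) X"
  shows "separable G X"
proof -
  have subN: "subgroup N G" using N by (simp add: finite_index_subgroup_def)
  interpret N: group "G\<lparr>carrier := N\<rparr>" using subN by (rule subgroup_imp_group)
  have XN: "X \<subseteq> N" "openin (profinite_topology (G\<lparr>carrier := N\<rparr>)) (N - X)"
    using X N.topspace_profinite unfolding separable_def closedin_def by auto
  have NG: "N \<subseteq> carrier G" using subN by (rule subgroup.subset)
  have "carrier G - N = \<Union> (rcosets N - {N})"
  proof -
    have "C \<inter> N = {}" if "C \<in> rcosets N" "C \<noteq> N" for C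
      using that rcos_disjoint[OF subN] subgroup.subgroup_in_rcosets[OF subN is_group]
      unfolding pairwise_def disjnt_def by blast
    moreover have "N \<in> rcosets N"
      using subgroup.subgroup_in_rcosets[OF subN is_group] .
    then have "N \<union> \<Union> (rcosets N - {N}) = carrier G"
      unfolding rcosets_part_G[OF subN, symmetric] by auto
    moreover have "N \<inter> \<Union> (rcosets N - {N}) = {}" using calculation(1) by auto
    ultimately show ?thesis by auto
  qed
  also have "openin (profinite_topology G) \<dots>"
    using openin_profinite_coset[OF N] by (intro openin_Union) auto
  finally have "openin (profinite_topology G) ((carrier G - N) \<union> (N - X))"
    using openin_finite_index_subgroup[OF N XN(2)] by (intro openin_Un)
  moreover have "(carrier G - N) \<union> (N - X) = carrier G - X" using XN(1) NG by blast
  ultimately show ?thesis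
    using XN(1) NG by (auto simp: separable_def closedin_def topspace_profinite)
qed

section \<open>Words and Schreier generators\<close>

lemma word_eval_Nil [simp]: "word_eval G [] = \<one>\<^bsub>G\<^esub>"
  by (simp add: word_eval_def)

lemma word_eval_Cons:
  "word_eval G (c # w) = (if snd c then fst c else inv\<^bsub>G\<^esub> fst c) \<otimes>\<^bsub>G\<^esub> word_eval G w"
  by (cases c) (simp add: word_eval_def)

lemma (in group) word_eval_closed:
  "A \<subseteq> carrier G \<Longrightarrow> w \<in> lists (signed_letters A) \<Longrightarrow> word_eval G w \<in> carrier G"
  by (induction w) (auto simp: word_eval_Cons)

lemma (in group) word_eval_append:
  assumes "A \<subseteq> carrier G" "u \<in> lists (signed_letters A)" "v \<in> lists (signed_letters A)"
  shows "word_eval G (u @ v) = word_eval G u \<otimes> word_eval G v"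
  using assms(2)
proof (induction u)
  case Nil
  then show ?case using word_eval_closed[OF assms(1,3)] by simp
next
  case (Cons c u)
  then show ?case
    using word_eval_closed[OF assms(1,3)] word_eval_closed[OF assms(1), of u] assms(1)
    by (auto simp: word_eval_Cons m_assoc)
qed

lemma (in group) word_eval_concat_map:
  assumes "A \<subseteq> carrier G" "B \<subseteq> carrier G" "w \<in> lists (signed_letters B)"
    and "\<And>b. b \<in> signed_letters B \<Longrightarrow> h b \<in> lists (signed_letters A) \<and> word_eval G (h b) = word_eval G [b]"
  shows "concat (map h w) \<in> lists (signed_letters A) \<and> word_eval G (concat (map h w)) = word_eval G w"
  using assms(3)
proof (induction w)
  case (Cons b w)
  have b: "h b \<in> lists (signed_letters A)" "word_eval G (h b) = word_eval G [b]"
    using assms(4) Cons.hyps by auto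
  have "word_eval G (b # w) = word_eval G [b] \<otimes> word_eval G w"
    using word_eval_append[OF assms(2), of "[b]" w] Cons.hyps by simp
  then show ?case using b Cons.IH word_eval_append[OF assms(1) b(1)] by simp
qed simp

lemma (in group) generate_eq_words:
  assumes A: "A \<subseteq> carrier G"
  shows "generate G A = word_eval G ` lists (signed_letters A)"
proof
  show "generate G A \<subseteq> word_eval G ` lists (signed_letters A)"
  proof
    fix x assume "x \<in> generate G A"
    then show "x \<in> word_eval G ` lists (signed_letters A)"
    proof induction
      case one
      show ?case by (rule image_eqI[of _ _ "[]"]) auto
    next
      case (incl a)
      then show ?case using A by (intro image_eqI[of _ _ "[(a, True)]"]) (auto simp: word_eval_Cons)
    next
      case (inv a)
      then show ?case using A by (intro image_eqI[of _ _ "[(a, False)]"]) (auto simp: word_eval_Cons)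
    next
      case (eng x y)
      then obtain u v where uv: "u \<in> lists (signed_letters A)" "v \<in> lists (signed_letters A)"
        "x = word_eval G u" "y = word_eval G v" by blast
      then have "x \<otimes> y = word_eval G (u @ v)" using word_eval_append[OF A] by simp
      moreover have "u @ v \<in> lists (signed_letters A)" using uv by simp
      ultimately show ?case by (rule image_eqI)
    qed
  qed
  have "word_eval G w \<in> generate G A" if "w \<in> lists (signed_letters A)" for w
    using that
  proof (induction w)
    case Nil
    show ?case by (simp add: generate.one)
  next
    case (Cons c w)
    then show ?case
      by (cases c) (auto simp: word_eval_Cons intro!: generate.eng intro: generate.incl generate.inv)
  qed
  then show "word_eval G ` lists (signed_letters A) \<subseteq> generate G A" by blast
qed

lemma (in group) word_eval_subgroup:
  assumes "subgroup N G" "B \<subseteq> N" "w \<in> lists (signed_letters B)"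
  shows "word_eval (G\<lparr>carrier := N\<rparr>) w = word_eval G w"
  using assms(3)
proof (induction w)
  case (Cons c w)
  then have "fst c \<in> N" using assms(2) by auto
  then show ?case using Cons.IH assms(1) by (simp add: word_eval_Cons)
qed simp

lemma (in group) finite_generating_set_subgroup:
  assumes "subgroup N G" "finite B" "B \<subseteq> carrier G" "generate G B = N"
  shows "finite_generating_set (G\<lparr>carrier := N\<rparr>) B"
proof -
  have "B \<subseteq> N" using assms(4) generate.incl[of _ B G] by blast
  then show ?thesis
    using assms generate_consistent[OF _ assms(1), of B] by (simp add: finite_generating_set_def)
qed

text \<open>Schreier's lemma, for the subgroup \<open>generate G S \<inter> N\<close> of \<open>generate G S\<close>. Multiplying coset
  representatives by generators on the right and splitting off the new representative produces the
  elements \<open>t e t'\<inverse>\<close>. The identity is left out of the generators so that no generator is represented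
  by the empty word, as inverse homomorphisms require below.\<close>

lemma (in group) finite_index_generators:
  assumes N: "finite_index_subgroup N G" and S: "finite S" "S \<subseteq> carrier G"
  obtains B where "finite B" "B \<subseteq> carrier G" "\<one> \<notin> B" "generate G B = generate G S \<inter> N"
proof -
  have subN: "subgroup N G" using N by (simp add: finite_index_subgroup_def)
  interpret N: subgroup N G by (rule subN)
  let ?H = "generate G S"
  interpret H: subgroup ?H G using generate_is_subgroup[OF S(2)] .
  have HG: "?H \<subseteq> carrier G" using generate_incl[OF S(2)] .
  obtain T where T: "finite T" "T \<subseteq> ?H" "\<And>x. x \<in> ?H \<Longrightarrow> \<exists>t\<in>T. x \<otimes> inv t \<in> N"
    using finite_representatives[OF N HG] by blast
  define E where "E = (\<lambda>c. word_eval G [c]) ` signed_letters S"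
  have E: "finite E" "E \<subseteq> ?H"
    using S generate_eq_words[OF S(2)] unfolding E_def by auto
  define B where "B = N \<inter> (T \<union> (\<lambda>(t, e, t'). t \<otimes> e \<otimes> inv t') ` (insert \<one> T \<times> E \<times> T)) - {\<one>}"
  have BN: "B \<subseteq> ?H \<inter> N"
  proof -
    have "t \<otimes> e \<otimes> inv t' \<in> ?H" if "t \<in> insert \<one> T" "e \<in> E" "t' \<in> T" for t e t'
      using that T(2) E(2) by (auto intro!: H.m_closed H.m_inv_closed)
    then show ?thesis using T(2) unfolding B_def by auto
  qed
  have BG: "B \<subseteq> carrier G" using BN HG by blast
  interpret B: subgroup "generate G B" G using generate_is_subgroup[OF BG] .
  have inB: "x \<in> generate G B"
    if "x \<in> N" "x \<in> insert \<one> T \<or> (\<exists>t\<in>insert \<one> T. \<exists>e\<in>E. \<exists>t'\<in>T. x = t \<otimes> e \<otimes> inv t')" for x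
  proof (cases "x = \<one>")
    case False
    from that(2) have "x \<in> T \<union> (\<lambda>(t, e, t'). t \<otimes> e \<otimes> inv t') ` (insert \<one> T \<times> E \<times> T)"
    proof
      assume "\<exists>t\<in>insert \<one> T. \<exists>e\<in>E. \<exists>t'\<in>T. x = t \<otimes> e \<otimes> inv t'"
      then obtain t e t' where "t \<in> insert \<one> T" "e \<in> E" "t' \<in> T" "x = t \<otimes> e \<otimes> inv t'" by blast
      then show ?thesis by (intro UnI2 image_eqI[of _ _ "(t, e, t')"]) auto
    qed (use False in simp)
    then have "x \<in> B" unfolding B_def using that(1) False by blast
    then show ?thesis by (rule generate.incl)
  qed (simp add: generate.one)
  have word: "\<exists>b\<in>generate G B. \<exists>t\<in>insert \<one> T. word_eval G w = b \<otimes> t"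
    if "w \<in> lists (signed_letters S)" for w
    using that
  proof (induction w rule: rev_induct)
    case Nil
    show ?case by (rule bexI[of _ \<one>]) (auto simp: generate.one)
  next
    case (snoc c w)
    then have "w \<in> lists (signed_letters S)" by simp
    from snoc.IH[OF this] obtain b t where
      bt: "b \<in> generate G B" "t \<in> insert \<one> T" "word_eval G w = b \<otimes> t" by blast
    let ?e = "word_eval G [c]"
    have e: "?e \<in> E" using snoc.prems by (auto simp: E_def)
    have eH: "?e \<in> ?H" "t \<in> ?H" using e E(2) bt(2) T(2) by auto
    then obtain t' where t': "t' \<in> T" "(t \<otimes> ?e) \<otimes> inv t' \<in> N" using T(3) by blast
    have *: "?e \<in> carrier G" "t \<in> carrier G" "t' \<in> carrier G" "b \<in> carrier G"
      using eH t' T(2) HG bt(1) by auto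
    have "t \<otimes> ?e \<otimes> inv t' \<in> generate G B"
      by (rule inB[OF t'(2)]) (use bt(2) e t'(1) in blast)
    then have "b \<otimes> (t \<otimes> ?e \<otimes> inv t') \<in> generate G B" using bt(1) by simp
    moreover have "word_eval G (w @ [c]) = (b \<otimes> (t \<otimes> ?e \<otimes> inv t')) \<otimes> t'"
      using word_eval_append[OF S(2), of w "[c]"] snoc.prems bt(3) * by (simp add: m_assoc)
    ultimately show ?case using t'(1) by blast
  qed
  have "?H \<inter> N \<subseteq> generate G B"
  proof
    fix x assume x: "x \<in> ?H \<inter> N"
    then obtain w where w: "w \<in> lists (signed_letters S)" "x = word_eval G w"
      unfolding generate_eq_words[OF S(2)] by blast
    obtain b t where bt: "b \<in> generate G B" "t \<in> insert \<one> T" "x = b \<otimes> t"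
      using word[OF w(1)] w(2) by blast
    have "generate G B \<subseteq> N" using generate_subgroup_incl[OF _ subN, of B] BN by blast
    then have "b \<in> N" using bt(1) by blast
    have tG: "t \<in> carrier G" using bt(2) T(2) HG by auto
    have "t = inv b \<otimes> x" using bt(3) tG \<open>b \<in> N\<close> by simp
    then have "t \<in> N" using \<open>b \<in> N\<close> x by simp
    then have "t \<in> generate G B" using bt(2) by (intro inB) auto
    then show "x \<in> generate G B" using bt by simp
  qed
  moreover have "generate G B \<subseteq> ?H \<inter> N"
    using generate_subgroup_incl[OF BN] subgroups_Inter_pair[OF H.subgroup_axioms subN] by blast
  moreover have "finite B" unfolding B_def using T(1) E(1) by simp
  moreover have "\<one> \<notin> B" unfolding B_def by simp
  ultimately show ?thesis using that[of B] BG by blast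
qed

section \<open>Translating and restricting the six classes\<close>

text \<open>The two prescribed values \<open>g\<close> and \<open>\<one>\<close> are compatible because they represent the same coset
  only if they are equal.\<close>

lemma (in group) coset_representative_map:
  assumes N: "finite_index_subgroup N G" and g: "g \<in> carrier G" "g \<in> N \<longrightarrow> g = \<one>"
  obtains \<rho> where "finite (\<rho> ` carrier G)" "\<rho> g = g" "\<rho> \<one> = \<one>"
    "\<And>x. x \<in> carrier G \<Longrightarrow> \<rho> x \<in> carrier G \<and> x \<otimes> inv (\<rho> x) \<in> N"
    "\<And>x y. x \<in> carrier G \<Longrightarrow> y \<in> carrier G \<Longrightarrow> x \<otimes> inv y \<in> N \<Longrightarrow> \<rho> x = \<rho> y"
proof -
  have subN: "subgroup N G" and finN: "finite (rcosets N)"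
    using N by (simp_all add: finite_index_subgroup_def)
  define rep where "rep C = (if C = N then \<one> else if C = N #> g then g else SOME x. x \<in> C)" for C
  define \<rho> where "\<rho> x = rep (N #> x)" for x
  have N1: "N #> \<one> = N" using coset_mult_one[OF subgroup.subset[OF subN]] .
  have rep: "rep C \<in> C" if "x \<in> carrier G" "C = N #> x" for C x
  proof -
    have "x \<in> C" using that rcos_self[OF that(1) subN] by simp
    then have "(SOME x. x \<in> C) \<in> C" by (rule someI)
    moreover have "\<one> \<in> N" "g \<in> N #> g"
      using subgroup.one_closed[OF subN] rcos_self[OF g(1) subN] by auto
    ultimately show ?thesis by (simp add: rep_def)
  qed
  have "\<rho> x \<in> carrier G \<and> x \<otimes> inv (\<rho> x) \<in> N" if x: "x \<in> carrier G" for x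
  proof -
    have mem: "\<rho> x \<in> N #> x" unfolding \<rho>_def using rep x by blast
    then have c: "\<rho> x \<in> carrier G"
      using r_coset_subset_G[OF subgroup.subset[OF subN] x] by blast
    have "N #> x = N #> \<rho> x" using repr_independence[OF mem x subN] .
    then show ?thesis using r_coset_eq_iff[OF subN x c] c by blast
  qed
  moreover have "\<rho> x = \<rho> y" if "x \<in> carrier G" "y \<in> carrier G" "x \<otimes> inv y \<in> N" for x y
    using r_coset_eq_iff[OF subN that(1,2)] that(3) by (simp add: \<rho>_def)
  moreover have "finite (\<rho> ` carrier G)"
  proof (rule finite_subset)
    show "\<rho> ` carrier G \<subseteq> rep ` (rcosets N)" by (auto simp: \<rho>_def RCOSETS_def)
  qed (use finN in simp)
  moreover have "\<rho> \<one> = \<one>" by (simp add: \<rho>_def rep_def N1)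
  moreover have "\<rho> g = g"
    using g rcos_self[OF g(1) subN] by (auto simp: \<rho>_def rep_def)
  ultimately show ?thesis using that by blast
qed

text \<open>Schreier rewriting. The states are coset representatives of \<open>N\<close>, and reading \<open>c\<close> in state \<open>t\<close>
  writes a word for the Schreier generator \<open>t c t'\<inverse>\<close>, where \<open>t'\<close> is the representative of \<open>t c\<close>.
  These outputs telescope: a run on \<open>w\<close> from \<open>g\<close> to \<open>t'\<close> writes \<open>g w t'\<inverse>\<close>. It ends in \<open>\<one>\<close> exactly if
  \<open>g w \<in> N\<close>, and then it writes \<open>g w\<close>. The state \<open>g\<close> has to be a representative itself, whence
  the last hypothesis.\<close>

lemma (in group) restriction_transducer:
  assumes N: "finite_index_subgroup N G"
    and A: "finite A" "A \<subseteq> carrier G"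
    and B: "finite B" "B \<subseteq> carrier G" "generate G B = N"
    and g: "g \<in> carrier G" "g \<in> N \<longrightarrow> g = \<one>"
  obtains \<delta> where "finite \<delta>" "outputs_over \<delta> (signed_letters B)"
    "\<And>L. L \<subseteq> lists (signed_letters A) \<Longrightarrow>
      word_eval G ` transduction \<delta> g \<one> L = (g <# (word_eval G ` L)) \<inter> N"
proof -
  interpret N: subgroup N G using N by (simp add: finite_index_subgroup_def)
  obtain \<rho> where \<rho>: "finite (\<rho> ` carrier G)" "\<rho> g = g" "\<rho> \<one> = \<one>"
      "\<And>x. x \<in> carrier G \<Longrightarrow> \<rho> x \<in> carrier G \<and> x \<otimes> inv (\<rho> x) \<in> N"
      "\<And>x y. x \<in> carrier G \<Longrightarrow> y \<in> carrier G \<Longrightarrow> x \<otimes> inv y \<in> N \<Longrightarrow> \<rho> x = \<rho> y"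
    using coset_representative_map[OF N g] by blast
  have "\<forall>n\<in>N. \<exists>w\<in>lists (signed_letters B). word_eval G w = n"
    unfolding B(3)[symmetric] generate_eq_words[OF B(2)] by blast
  then obtain \<omega> where \<omega>: "\<And>n. n \<in> N \<Longrightarrow> \<omega> n \<in> lists (signed_letters B) \<and> word_eval G (\<omega> n) = n"
    by metis
  define val where "val c = word_eval G [c]" for c
  have val: "val c \<in> carrier G" if "c \<in> signed_letters A" for c
    using that word_eval_closed[OF A(2), of "[c]"] by (simp add: val_def)
  have eval_Cons: "word_eval G (c # w) = val c \<otimes> word_eval G w"
    if "c \<in> signed_letters A" "w \<in> lists (signed_letters A)" for c w
    using word_eval_append[OF A(2), of "[c]" w] that by (simp add: val_def)
  define out where "out t c = \<omega> (t \<otimes> val c \<otimes> inv (\<rho> (t \<otimes> val c)))" for t c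
  have out: "out t c \<in> lists (signed_letters B)"
      "word_eval G (out t c) = t \<otimes> val c \<otimes> inv (\<rho> (t \<otimes> val c))"
    if "t \<in> carrier G" "c \<in> signed_letters A" for t c
    using \<omega>[of "t \<otimes> val c \<otimes> inv (\<rho> (t \<otimes> val c))"] \<rho>(4)[of "t \<otimes> val c"] val that
    unfolding out_def by auto
  define \<delta> where "\<delta> = (\<lambda>(t, c). (t, c, out t c, \<rho> (t \<otimes> val c))) ` (\<rho> ` carrier G \<times> signed_letters A)"
  have T: "t \<in> carrier G" "\<rho> t = t" if "t \<in> \<rho> ` carrier G" for t
  proof -
    from that obtain x where x: "t = \<rho> x" "x \<in> carrier G" by (rule imageE)
    then show t: "t \<in> carrier G" using \<rho>(4) by simp
    show "\<rho> t = t" using \<rho>(5)[OF x(2) t] \<rho>(4)[OF x(2)] x(1) by simp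
  qed
  have "finite \<delta>" unfolding \<delta>_def using \<rho>(1) A(1) by simp
  moreover have over: "outputs_over \<delta> (signed_letters B)"
    using out(1) T(1) by (auto simp: outputs_over_def \<delta>_def)
  moreover have "word_eval G ` transduction \<delta> g \<one> L = (g <# (word_eval G ` L)) \<inter> N"
    if L: "L \<subseteq> lists (signed_letters A)" for L
  proof -
    have shift: "\<rho> (\<rho> x \<otimes> y) = \<rho> (x \<otimes> y)" if "x \<in> carrier G" "y \<in> carrier G" for x y
    proof -
      have r: "\<rho> x \<in> carrier G" "x \<otimes> inv (\<rho> x) \<in> N" using \<rho>(4) that by auto
      have "(x \<otimes> y) \<otimes> inv (\<rho> x \<otimes> y) = x \<otimes> inv (\<rho> x)"
        using that r by (simp add: m_assoc inv_mult_group)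
      then show ?thesis using \<rho>(5)[of "x \<otimes> y" "\<rho> x \<otimes> y"] that r by simp
    qed
    have sound: "w \<in> lists (signed_letters A) \<and> q = \<rho> (p \<otimes> word_eval G w) \<and>
        word_eval G y = p \<otimes> word_eval G w \<otimes> inv q"
      if "run \<delta> p w y q" "p \<in> \<rho> ` carrier G" for p w y q
      using that
    proof (induction rule: run.induct)
      case (nil p)
      then show ?case using T[OF nil.prems] by simp
    next
      case (step p c x q w y r)
      have c: "c \<in> signed_letters A" and x: "x = out p c" and q: "q = \<rho> (p \<otimes> val c)"
        using step.hyps(1) by (auto simp: \<delta>_def)
      have pG: "p \<in> carrier G" using T(1)[OF step.prems] .
      have qT: "q \<in> \<rho> ` carrier G" unfolding q by (rule imageI) (simp add: pG val[OF c])
      have w: "w \<in> lists (signed_letters A)" and r: "r = \<rho> (q \<otimes> word_eval G w)"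
        and y: "word_eval G y = q \<otimes> word_eval G w \<otimes> inv r"
        using step.IH[OF qT] by auto
      have wG: "word_eval G w \<in> carrier G" using word_eval_closed[OF A(2) w] .
      have qG: "q \<in> carrier G" using T(1)[OF qT] .
      have rG: "r \<in> carrier G" unfolding r using \<rho>(4) qG wG by simp
      have "word_eval G (x @ y) = word_eval G x \<otimes> word_eval G y"
        using word_eval_append[OF B(2)] out(1)[OF pG c] run_output[OF step.hyps(2) over] x by simp
      also have "\<dots> = (p \<otimes> val c \<otimes> inv q) \<otimes> (q \<otimes> word_eval G w \<otimes> inv r)"
        using out(2)[OF pG c] x q y by simp
      also have "\<dots> = p \<otimes> word_eval G (c # w) \<otimes> inv r"
        using pG val[OF c] qG wG rG by (simp add: eval_Cons[OF c w] m_assoc)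
      finally have "word_eval G (x @ y) = p \<otimes> word_eval G (c # w) \<otimes> inv r" .
      moreover have "r = \<rho> (p \<otimes> word_eval G (c # w))"
        unfolding r q eval_Cons[OF c w] using shift[of "p \<otimes> val c"] pG val[OF c] wG
        by (simp add: m_assoc)
      ultimately show ?case using c w by simp
    qed
    have total: "\<exists>y. run \<delta> p w y (\<rho> (p \<otimes> word_eval G w))"
      if "w \<in> lists (signed_letters A)" "p \<in> \<rho> ` carrier G" for w p
      using that
    proof (induction w arbitrary: p rule: list.induct)
      case Nil
      then show ?case using T[OF Nil.prems(2)] run.nil[of \<delta> p] by auto
    next
      case (Cons c w)
      have c: "c \<in> signed_letters A" and w: "w \<in> lists (signed_letters A)" using Cons by auto
      have pG: "p \<in> carrier G" using T(1)[OF Cons.prems(2)] .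
      let ?q = "\<rho> (p \<otimes> val c)"
      have "?q \<in> \<rho> ` carrier G" by (rule imageI) (simp add: pG val[OF c])
      then obtain y where "run \<delta> ?q w y (\<rho> (?q \<otimes> word_eval G w))" using Cons.IH[OF w] by blast
      moreover have "\<rho> (?q \<otimes> word_eval G w) = \<rho> (p \<otimes> word_eval G (c # w))"
        using shift[of "p \<otimes> val c"] pG val[OF c] word_eval_closed[OF A(2) w]
        by (simp add: eval_Cons[OF c w] m_assoc)
      moreover have "(p, c, out p c, ?q) \<in> \<delta>" using c Cons.prems by (force simp: \<delta>_def)
      ultimately show ?case using run.step[of p c "out p c" ?q] by fastforce
    qed
    have gT: "g \<in> \<rho> ` carrier G" using \<rho>(2) g(1) by force
    show ?thesis
    proof (intro equalityI subsetI)
      fix x assume "x \<in> word_eval G ` transduction \<delta> g \<one> L"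
      then obtain w y where w: "w \<in> L" "run \<delta> g w y \<one>" "x = word_eval G y"
        by (auto simp: transduction_def)
      have wG: "word_eval G w \<in> carrier G" using word_eval_closed[OF A(2)] w(1) L by blast
      have one: "\<rho> (g \<otimes> word_eval G w) = \<one>" and x: "x = g \<otimes> word_eval G w"
        using sound[OF w(2) gT] w(3) g(1) wG by simp_all
      have "x \<in> N"
        using \<rho>(4)[of "g \<otimes> word_eval G w"] g(1) wG unfolding one x by simp
      then show "x \<in> (g <# (word_eval G ` L)) \<inter> N" using w(1) x by (auto simp: l_coset_def)
    next
      fix x assume "x \<in> (g <# (word_eval G ` L)) \<inter> N"
      then obtain w where w: "w \<in> L" "x = g \<otimes> word_eval G w" "x \<in> N" by (auto simp: l_coset_def)
      have wG: "word_eval G w \<in> carrier G" using word_eval_closed[OF A(2)] w(1) L by blast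
      have "\<rho> (g \<otimes> word_eval G w) = \<one>"
        using \<rho>(5)[of "g \<otimes> word_eval G w" \<one>] \<rho>(3) w g(1) wG by simp
      then obtain y where y: "run \<delta> g w y \<one>" using total[OF _ gT, of w] w(1) L by force
      then have "word_eval G y = x" using sound[OF y gT] w(2) g(1) wG by simp
      then show "x \<in> word_eval G ` transduction \<delta> g \<one> L"
        using y w(1) by (auto simp: transduction_def)
    qed
  qed
  ultimately show ?thesis using that by blast
qed

text \<open>Write every generator from \<open>B\<close> as a word \<open>h b\<close> over \<open>A\<close>, and \<open>g\<inverse>\<close> as a word \<open>v\<close>. A word \<open>w\<close> over
  \<open>B\<close> has value in \<open>g K\<close> iff \<open>v @ concat (map h w)\<close> has value in \<open>K\<close>.\<close>

lemma (in group) preimage_transducer: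
  assumes A: "A \<subseteq> carrier G" "generate G A = carrier G"
    and B: "finite B" "B \<subseteq> carrier G" "\<one> \<notin> B" and g: "g \<in> carrier G"
  shows "\<exists>\<delta> (p :: ('a \<times> bool) list) q. finite \<delta> \<and> outputs_over \<delta> (signed_letters B) \<and>
    (\<forall>K. K \<subseteq> carrier G \<longrightarrow>
      transduction \<delta> p q {w \<in> lists (signed_letters A). word_eval G w \<in> K} =
      {w \<in> lists (signed_letters B). word_eval G w \<in> g <# K})"
proof -
  have word: "\<exists>w\<in>lists (signed_letters A). word_eval G w = x" if "x \<in> carrier G" for x
    using that unfolding A(2)[symmetric] generate_eq_words[OF A(1)] by blast
  obtain v where v: "v \<in> lists (signed_letters A)" "word_eval G v = inv g"
    using word[of "inv g"] g by auto
  have valG: "word_eval G [b] \<in> carrier G" if "b \<in> signed_letters B" for b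
    using word_eval_closed[OF B(2), of "[b]"] that by simp
  have "\<forall>b\<in>signed_letters B. \<exists>w. w \<in> lists (signed_letters A) \<and> word_eval G w = word_eval G [b]"
    using word valG by blast
  from bchoice[OF this] obtain h where "\<forall>b\<in>signed_letters B.
      h b \<in> lists (signed_letters A) \<and> word_eval G (h b) = word_eval G [b]"
    by (rule exE)
  note h = bspec[OF this]
  have ne: "h b \<noteq> []" if "b \<in> signed_letters B" for b
  proof
    assume "h b = []"
    then have "word_eval G [b] = \<one>" using h[OF that] by simp
    moreover have "fst b \<in> B" "fst b \<in> carrier G" using that B(2) by auto
    ultimately have "fst b = \<one>"
      by (auto simp: word_eval_Cons inv_eq_1_iff split: if_splits)
    then show False using \<open>fst b \<in> B\<close> B(3) by simp
  qed
  have fin: "finite (signed_letters B)" using B(1) by simp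
  have "\<exists>\<delta>. finite \<delta> \<and> outputs_over \<delta> (signed_letters B) \<and>
      (\<forall>L. transduction \<delta> v [] L = {y \<in> lists (signed_letters B). v @ concat (map h y) \<in> L})"
    using fin ne by (rule nonerasing_inverse_transducer)
  then obtain \<delta> where \<delta>: "finite \<delta>" "outputs_over \<delta> (signed_letters B)"
    "\<forall>L. transduction \<delta> v [] L = {y \<in> lists (signed_letters B). v @ concat (map h y) \<in> L}"
    by (elim exE conjE)
  have "transduction \<delta> v [] {w \<in> lists (signed_letters A). word_eval G w \<in> K} =
      {w \<in> lists (signed_letters B). word_eval G w \<in> g <# K}" if K: "K \<subseteq> carrier G" for K
  proof -
    have "v @ concat (map h y) \<in> {w \<in> lists (signed_letters A). word_eval G w \<in> K} \<longleftrightarrow>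
        word_eval G y \<in> g <# K" if y: "y \<in> lists (signed_letters B)" for y
    proof -
      note hy = word_eval_concat_map[OF A(1) B(2) y h]
      have yG: "word_eval G y \<in> carrier G" using word_eval_closed[OF B(2) y] .
      have "word_eval G (v @ concat (map h y)) = inv g \<otimes> word_eval G y"
        using word_eval_append[OF A(1) v(1)] hy v(2) by simp
      moreover have "inv g \<otimes> word_eval G y \<in> K \<longleftrightarrow> word_eval G y \<in> g <# K"
      proof
        assume "inv g \<otimes> word_eval G y \<in> K"
        moreover have "word_eval G y = g \<otimes> (inv g \<otimes> word_eval G y)" using g yG by simp
        ultimately show "word_eval G y \<in> g <# K" unfolding l_coset_def by blast
      next
        assume "word_eval G y \<in> g <# K"
        then obtain s where "s \<in> K" "word_eval G y = g \<otimes> s" by (auto simp: l_coset_def)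
        then show "inv g \<otimes> word_eval G y \<in> K" using g K by auto
      qed
      ultimately show ?thesis using v(1) hy by simp
    qed
    then show ?thesis unfolding \<delta>(3)[rule_format] by blast
  qed
  then show ?thesis by (intro exI[of _ \<delta>] exI[of _ v] exI[of _ "[]"] conjI allI impI \<delta>(1,2))
qed

lemma (in group) Fin_restrict:
  "K \<in> Fin G \<Longrightarrow> (g <# K) \<inter> N \<in> Fin (G\<lparr>carrier := N\<rparr>)"
  by (simp add: Fin_def l_coset_def)

text \<open>If \<open>n\<close> lies in \<open>g H y \<inter> N\<close>, this set is the coset of \<open>n\<close> with respect to \<open>g H g\<inverse> \<inter> N\<close>, which is
  finitely generated by Schreier's lemma.\<close>

lemma (in group) Coset_restrict:
  assumes N: "finite_index_subgroup N G" and K: "K \<in> Coset G" and g: "g \<in> carrier G"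
    and ne: "(g <# K) \<inter> N \<noteq> {}"
  shows "(g <# K) \<inter> N \<in> Coset (G\<lparr>carrier := N\<rparr>)"
proof -
  have subN: "subgroup N G" using N by (simp add: finite_index_subgroup_def)
  interpret N: subgroup N G by (rule subN)
  obtain S y where S: "finite S" "S \<subseteq> carrier G" and y: "y \<in> carrier G" and K: "K = generate G S #> y"
    using K by (auto simp: Coset_def)
  let ?H = "generate G S"
  interpret H: subgroup ?H G using generate_is_subgroup[OF S(2)] .
  let ?c = "\<lambda>x. g \<otimes> x \<otimes> inv g"
  interpret c: group_hom G G ?c
    by unfold_locales (use g in \<open>auto simp: hom_def m_assoc\<close>)
  obtain h where h: "h \<in> ?H" "g \<otimes> (h \<otimes> y) \<in> N"
    using ne by (auto simp: K l_coset_def r_coset_def)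
  define n where "n = g \<otimes> (h \<otimes> y)"
  have "finite (?c ` S)" "?c ` S \<subseteq> carrier G" using S g by auto
  from finite_index_generators[OF N this] obtain B where
    B: "finite B" "B \<subseteq> carrier G" "generate G B = generate G (?c ` S) \<inter> N" by metis
  have gen: "generate G B = ?c ` ?H \<inter> N" using B(3) c.generate_img[OF S(2)] by simp
  have BN: "B \<subseteq> N" using generate.incl[of _ B G] B(3) by blast
  have "(g <# K) \<inter> N = generate G B #> n"
  proof (intro equalityI subsetI)
    fix x assume "x \<in> (g <# K) \<inter> N"
    then obtain h' where h': "h' \<in> ?H" "x = g \<otimes> (h' \<otimes> y)" "x \<in> N"
      by (auto simp: K l_coset_def r_coset_def)
    have "x \<otimes> inv n = ?c (h' \<otimes> inv h)"
      using h(1) h'(1,2) g y by (simp add: n_def m_assoc inv_mult_group)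
    moreover have "x \<otimes> inv n \<in> N" using h'(3) h(2) by (simp add: n_def)
    moreover have "h' \<otimes> inv h \<in> ?H" using h(1) h'(1) by simp
    ultimately have "x \<otimes> inv n \<in> generate G B" unfolding gen by blast
    moreover have "x = (x \<otimes> inv n) \<otimes> n"
      using h(2) h'(3) by (simp add: n_def m_assoc)
    ultimately show "x \<in> generate G B #> n" unfolding r_coset_def by blast
  next
    fix x assume "x \<in> generate G B #> n"
    then obtain h' where h': "h' \<in> ?H" "?c h' \<in> N" "x = ?c h' \<otimes> n"
      unfolding gen r_coset_def by auto
    have "x = g \<otimes> ((h' \<otimes> h) \<otimes> y)" using h' h(1) g y by (simp add: n_def m_assoc)
    moreover have "h' \<otimes> h \<in> ?H" using h' h(1) by simp
    moreover have "x \<in> N" using h' h(2) by (simp add: n_def)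
    ultimately show "x \<in> (g <# K) \<inter> N" unfolding K l_coset_def r_coset_def by blast
  qed
  also have "\<dots> = generate (G\<lparr>carrier := N\<rparr>) B #>\<^bsub>G\<lparr>carrier := N\<rparr>\<^esub> n"
    using generate_consistent[OF BN subN] by simp
  finally show ?thesis using B(1) BN h(2) unfolding Coset_def n_def by auto
qed

lemma (in group) word_image_restrict:
  assumes N: "finite_index_subgroup N G" and A: "finite_generating_set G A"
    and L: "L \<subseteq> lists (signed_letters A)" and g: "g \<in> carrier G" "g \<in> N \<longrightarrow> g = \<one>"
  obtains B \<delta> p q where "finite_generating_set (G\<lparr>carrier := N\<rparr>) B" "finite \<delta>"
    "outputs_over \<delta> (signed_letters B)"
    "(g <# (word_eval G ` L)) \<inter> N = word_eval (G\<lparr>carrier := N\<rparr>) ` transduction (\<delta> :: ('a \<times> _) set) p q L"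
proof -
  have subN: "subgroup N G" using N by (simp add: finite_index_subgroup_def)
  have A: "finite A" "A \<subseteq> carrier G" "generate G A = carrier G"
    using A by (simp_all add: finite_generating_set_def)
  obtain B where B: "finite B" "B \<subseteq> carrier G" "generate G B = N"
    using finite_index_generators[OF N A(1,2)] A(3) subgroup.subset[OF subN] by (metis inf.absorb2)
  obtain \<delta> where \<delta>: "finite \<delta>" "outputs_over \<delta> (signed_letters B)"
    "\<And>L. L \<subseteq> lists (signed_letters A) \<Longrightarrow>
      word_eval G ` transduction \<delta> g \<one> L = (g <# (word_eval G ` L)) \<inter> N"
    using restriction_transducer[OF N A(1,2) B g] by blast
  have "transduction \<delta> g \<one> L \<subseteq> lists (signed_letters B)"
    using run_output[OF _ \<delta>(2)] unfolding transduction_def by blast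
  moreover have "B \<subseteq> N" using B(3) generate.incl[of _ B G] by blast
  ultimately have "word_eval (G\<lparr>carrier := N\<rparr>) ` transduction \<delta> g \<one> L = word_eval G ` transduction \<delta> g \<one> L"
    using word_eval_subgroup[OF subN] by (intro image_cong HOL.refl) blast
  then show ?thesis
    using that[OF finite_generating_set_subgroup[OF subN B] \<delta>(1,2), of g \<one>] \<delta>(3)[OF L] by simp
qed

lemma (in group) word_preimage_restrict:
  assumes N: "finite_index_subgroup N G" and A: "finite_generating_set G A"
    and K: "K \<subseteq> carrier G" and g: "g \<in> carrier G"
  obtains B \<delta> p q where "finite_generating_set (G\<lparr>carrier := N\<rparr>) B" "finite \<delta>"
    "outputs_over \<delta> (signed_letters B)"
    "{w \<in> lists (signed_letters B). word_eval (G\<lparr>carrier := N\<rparr>) w \<in> (g <# K) \<inter> N} =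
      transduction \<delta> (p :: ('a \<times> bool) list) q {w \<in> lists (signed_letters A). word_eval G w \<in> K}"
proof -
  have subN: "subgroup N G" using N by (simp add: finite_index_subgroup_def)
  have A: "finite A" "A \<subseteq> carrier G" "generate G A = carrier G"
    using A by (simp_all add: finite_generating_set_def)
  obtain B where B: "finite B" "B \<subseteq> carrier G" "\<one> \<notin> B" "generate G B = N"
    using finite_index_generators[OF N A(1,2)] A(3) subgroup.subset[OF subN] by (metis inf.absorb2)
  have BN: "B \<subseteq> N" using B(4) generate.incl[of _ B G] by blast
  obtain \<delta> and p q :: "('a \<times> bool) list"
  where \<delta>: "finite \<delta>" "outputs_over \<delta> (signed_letters B)"
    "\<forall>K. K \<subseteq> carrier G \<longrightarrow>
      transduction \<delta> p q {w \<in> lists (signed_letters A). word_eval G w \<in> K} =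
      {w \<in> lists (signed_letters B). word_eval G w \<in> g <# K}"
    using preimage_transducer[OF A(2,3) B(1-3) g] by (elim exE conjE)
  have "word_eval (G\<lparr>carrier := N\<rparr>) w = word_eval G w \<and> word_eval G w \<in> N"
    if "w \<in> lists (signed_letters B)" for w
    using word_eval_subgroup[OF subN BN that] generate_eq_words[OF B(2)] B(4) that by blast
  then have "{w \<in> lists (signed_letters B). word_eval (G\<lparr>carrier := N\<rparr>) w \<in> (g <# K) \<inter> N} =
      {w \<in> lists (signed_letters B). word_eval G w \<in> g <# K}"
    by (intro Collect_cong) (metis IntE IntI)
  then show ?thesis
    using that[OF finite_generating_set_subgroup[OF subN B(1,2,4)] \<delta>(1,2), of p q] \<delta>(3)[rule_format, OF K] by simp
qed

lemma context_free_subset_lists: "L \<in> context_free_languages \<Sigma> \<Longrightarrow> L \<subseteq> lists \<Sigma>"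
  by (auto simp: context_free_languages_def)

text \<open>The empty set is not a coset, so it has to be allowed as an exception.\<close>

theorem (in group) class_translate_restrict:
  fixes \<K> :: "('a, 'b) monoid_scheme \<Rightarrow> 'a set set"
  assumes N: "finite_index_subgroup N G" and \<K>: "\<K> \<in> {Fin, Coset, Rat, Rec, Alg, CF}"
    and K: "K \<in> \<K> G" and g: "g \<in> carrier G" "g \<in> N \<longrightarrow> g = \<one>"
  shows "(g <# K) \<inter> N = {} \<or> (g <# K) \<inter> N \<in> \<K> (G\<lparr>carrier := N\<rparr>)"
proof -
  consider "\<K> = Fin" | "\<K> = Coset" | "\<K> = Rat" | "\<K> = Rec" | "\<K> = Alg" | "\<K> = CF"
    using \<K> by blast
  then show ?thesis
  proof cases
    case 1
    then show ?thesis using Fin_restrict K by blast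
  next
    case 2
    then show ?thesis using Coset_restrict[OF N] K g(1) by blast
  next
    case 3
    then obtain A L where A: "finite_generating_set G A" and L: "L \<in> rational_languages (signed_letters A)"
      and KL: "K = word_eval G ` L" using K by (auto simp: Rat_def)
    obtain B \<delta> p q where "finite_generating_set (G\<lparr>carrier := N\<rparr>) B" "finite \<delta>"
      "outputs_over \<delta> (signed_letters B)"
      "(g <# K) \<inter> N = word_eval (G\<lparr>carrier := N\<rparr>) ` transduction (\<delta> :: ('a \<times> _) set) p q L"
      using word_image_restrict[OF N A rational_subset_lists[OF L] g] unfolding KL by blast
    then have "(g <# K) \<inter> N \<in> Rat (G\<lparr>carrier := N\<rparr>)"
      unfolding Rat_def using transduction_rational[OF L]
      by (intro CollectI exI[of _ B] exI[of _ "transduction \<delta> p q L"] conjI)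
    then show ?thesis using 3 by simp
  next
    case 5
    then obtain A L where A: "finite_generating_set G A" and L: "L \<in> context_free_languages (signed_letters A)"
      and KL: "K = word_eval G ` L" using K by (auto simp: Alg_def)
    obtain B \<delta> p q where "finite_generating_set (G\<lparr>carrier := N\<rparr>) B" "finite \<delta>"
      "outputs_over \<delta> (signed_letters B)"
      "(g <# K) \<inter> N = word_eval (G\<lparr>carrier := N\<rparr>) ` transduction (\<delta> :: ('a \<times> _) set) p q L"
      using word_image_restrict[OF N A context_free_subset_lists[OF L] g] unfolding KL by blast
    then have "(g <# K) \<inter> N \<in> Alg (G\<lparr>carrier := N\<rparr>)"
      unfolding Alg_def using transduction_context_free[OF L]
      by (intro CollectI exI[of _ B] exI[of _ "transduction \<delta> p q L"] conjI)
    then show ?thesis using 5 by simp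
  next
    case 4
    then obtain A where KG: "K \<subseteq> carrier G" and A: "finite_generating_set G A"
      and L: "{w \<in> lists (signed_letters A). word_eval G w \<in> K} \<in> rational_languages (signed_letters A)"
      using K by (auto simp: Rec_def)
    obtain B \<delta> p q where B: "finite_generating_set (G\<lparr>carrier := N\<rparr>) B" "finite \<delta>"
      "outputs_over \<delta> (signed_letters B)"
      "{w \<in> lists (signed_letters B). word_eval (G\<lparr>carrier := N\<rparr>) w \<in> (g <# K) \<inter> N} =
        transduction \<delta> (p :: ('a \<times> bool) list) q {w \<in> lists (signed_letters A). word_eval G w \<in> K}"
      using word_preimage_restrict[OF N A KG g(1)] by blast
    have "(g <# K) \<inter> N \<in> Rec (G\<lparr>carrier := N\<rparr>)"
      unfolding Rec_def using B(1) transduction_rational[OF L B(2,3), of p q]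
      unfolding B(4)[symmetric] by auto
    then show ?thesis using 4 by simp
  next
    case 6
    then obtain A where KG: "K \<subseteq> carrier G" and A: "finite_generating_set G A"
      and L: "{w \<in> lists (signed_letters A). word_eval G w \<in> K} \<in> context_free_languages (signed_letters A)"
      using K by (auto simp: CF_def)
    obtain B \<delta> p q where B: "finite_generating_set (G\<lparr>carrier := N\<rparr>) B" "finite \<delta>"
      "outputs_over \<delta> (signed_letters B)"
      "{w \<in> lists (signed_letters B). word_eval (G\<lparr>carrier := N\<rparr>) w \<in> (g <# K) \<inter> N} =
        transduction \<delta> (p :: ('a \<times> bool) list) q {w \<in> lists (signed_letters A). word_eval G w \<in> K}"
      using word_preimage_restrict[OF N A KG g(1)] by blast
    have "(g <# K) \<inter> N \<in> CF (G\<lparr>carrier := N\<rparr>)"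
      unfolding CF_def using B(1) transduction_context_free[OF L B(2,3), of p q]
      unfolding B(4)[symmetric] by auto
    then show ?thesis using 6 by simp
  qed
qed

section \<open>From twisted conjugacy in a normal subgroup to conjugacy\<close>

lemma (in group) power_in_finite_index:
  assumes N: "finite_index_subgroup N G" and b: "b \<in> carrier G"
  obtains k :: nat where "k > 0" "b [^] k \<in> N"
proof -
  have subN: "subgroup N G" and finN: "finite (rcosets N)"
    using N by (simp_all add: finite_index_subgroup_def)
  have "range (\<lambda>i :: nat. N #> b [^] i) \<subseteq> rcosets N"
    using b by (auto simp: RCOSETS_def)
  then have "finite (range (\<lambda>i :: nat. N #> b [^] i))" using finN by (rule finite_subset)
  then have "\<not> inj (\<lambda>i :: nat. N #> b [^] i)" using finite_imageD infinite_UNIV_nat by blast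
  then obtain i j :: nat where ij: "i < j" "N #> b [^] j = N #> b [^] i"
    unfolding inj_def by (metis nat_neq_iff)
  have "b [^] j = b [^] (j - i) \<otimes> b [^] i" using ij(1) b by (simp add: nat_pow_mult)
  moreover have "b [^] j \<otimes> inv (b [^] i) \<in> N" using ij(2) r_coset_eq_iff[OF subN] b by simp
  ultimately have "b [^] (j - i) \<in> N" using b by (simp add: m_assoc)
  then show ?thesis using that[of "j - i"] ij(1) by simp
qed

text \<open>Some positive power \<open>b\<^sup>k\<close> lies in \<open>N\<close>, and the \<open>k\<close>-th power of conjugation by \<open>b\<close> is then
  conjugation by an element of \<open>N\<close>. Automorphisms are extensional functions, hence the restricted
  abstraction.\<close>

lemma (in group) conjugation_Via:
  assumes N: "N \<lhd> G" "finite_index_subgroup N G" and b: "b \<in> carrier G"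
  shows "(\<lambda>y\<in>N. inv b \<otimes> y \<otimes> b) \<in> Via (G\<lparr>carrier := N\<rparr>)"
proof -
  interpret N: normal N G by (rule N)
  let ?\<phi> = "\<lambda>y\<in>N. inv b \<otimes> y \<otimes> b"
  have conj: "inv b \<otimes> y \<otimes> b \<in> N" "b \<otimes> y \<otimes> inv b \<in> N" if "y \<in> N" for y
    using N.inv_op_closed1[OF b that] N.inv_op_closed2[OF b that] by auto
  have "?\<phi> \<in> hom (G\<lparr>carrier := N\<rparr>) (G\<lparr>carrier := N\<rparr>)"
    using conj b by (auto simp: hom_def m_assoc)
  moreover have "bij_betw ?\<phi> N N"
    by (rule bij_betwI[of _ _ _ "\<lambda>y. b \<otimes> y \<otimes> inv b"]) (use conj b in \<open>auto simp: m_assoc\<close>)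
  ultimately have aut: "?\<phi> \<in> auto (G\<lparr>carrier := N\<rparr>)"
    by (simp add: auto_def Bij_def)
  obtain k :: nat where k: "k > 0" "b [^] k \<in> N"
    using power_in_finite_index[OF N(2) b] by blast
  have pow: "(?\<phi> ^^ i) x = inv (b [^] i) \<otimes> x \<otimes> b [^] i \<and> (?\<phi> ^^ i) x \<in> N"
    if "x \<in> N" for x and i :: nat
  proof (induction i)
    case (Suc i)
    have step: "(?\<phi> ^^ Suc i) x = inv b \<otimes> (?\<phi> ^^ i) x \<otimes> b"
      by (simp only: funpow.simps o_apply restrict_apply'[OF conjunct2[OF Suc.IH]])
    have mem: "(?\<phi> ^^ Suc i) x \<in> N" unfolding step using conj Suc.IH by blast
    have "inv b \<otimes> (inv (b [^] i) \<otimes> x \<otimes> b [^] i) \<otimes> b = inv (b [^] Suc i) \<otimes> x \<otimes> b [^] Suc i"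
      using that b by (simp add: m_assoc inv_mult_group)
    then have "(?\<phi> ^^ Suc i) x = inv (b [^] Suc i) \<otimes> x \<otimes> b [^] Suc i"
      unfolding step conjunct1[OF Suc.IH] .
    then show ?case using mem by (rule conjI)
  qed (use that in simp)
  have "inv\<^bsub>G\<lparr>carrier := N\<rparr>\<^esub> (b [^] k) = inv (b [^] k)"
    using m_inv_consistent[OF N.subgroup_axioms k(2)] .
  then show ?thesis
    unfolding Via_def using aut k pow by (auto intro!: exI[of _ k] bexI[of _ "b [^] k"])
qed

text \<open>Write a conjugating element as \<open>x = m r\<close> and the conjugated one as \<open>s = t\<inverse> n\<close> with \<open>m, n \<in> N\<close> and
  \<open>r, t \<in> T\<close>. Then \<open>x\<inverse> s x = (t r)\<inverse> (t m\<inverse> t\<inverse>) n m r\<close>, and \<open>(t m\<inverse> t\<inverse>) n m\<close> is a conjugate of \<open>n\<close>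
  twisted by the automorphism \<open>y \<mapsto> t y t\<inverse>\<close> of \<open>N\<close>.\<close>

lemma (in group) conjugacy_closure_decomposition:
  assumes N: "subgroup N G" and K: "K \<subseteq> carrier G" and T: "T \<subseteq> carrier G"
    "\<forall>x\<in>carrier G. \<exists>t\<in>T. x \<otimes> inv t \<in> N"
  shows "{inv x \<otimes> s \<otimes> x | x s. x \<in> carrier G \<and> s \<in> K} =
    (\<Union>t\<in>T. \<Union>r\<in>T. (\<lambda>z. inv (t \<otimes> r) \<otimes> z \<otimes> r) `
      {t \<otimes> inv m \<otimes> inv t \<otimes> n \<otimes> m | m n. m \<in> N \<and> n \<in> (t <# K) \<inter> N})" (is "?l = ?r")
proof
  interpret N: subgroup N G by (rule N)
  have key: "inv (t \<otimes> r) \<otimes> (t \<otimes> inv m \<otimes> inv t \<otimes> (t \<otimes> s) \<otimes> m) \<otimes> r = inv (m \<otimes> r) \<otimes> s \<otimes> (m \<otimes> r)"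
    if "t \<in> carrier G" "r \<in> carrier G" "m \<in> carrier G" "s \<in> carrier G" for t r m s
    using that by (simp add: m_assoc inv_mult_group)
  show "?l \<subseteq> ?r"
  proof
    fix z assume "z \<in> ?l"
    then obtain x s where z: "z = inv x \<otimes> s \<otimes> x" and x: "x \<in> carrier G" and s: "s \<in> K" by blast
    obtain r where r: "r \<in> T" "x \<otimes> inv r \<in> N" using T(2) x by blast
    have sG: "s \<in> carrier G" using s K by blast
    then obtain t where t: "t \<in> T" "inv s \<otimes> inv t \<in> N" using bspec[OF T(2), of "inv s"] by auto
    have G: "r \<in> carrier G" "t \<in> carrier G" using r t T(1) by auto
    have "inv (inv s \<otimes> inv t) \<in> N" using t(2) by simp
    then have n: "t \<otimes> s \<in> (t <# K) \<inter> N"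
      using s sG G by (auto simp: inv_mult_group l_coset_def)
    have "(x \<otimes> inv r) \<otimes> r = x" using x G by (simp add: m_assoc)
    then have "z = inv (t \<otimes> r) \<otimes> (t \<otimes> inv (x \<otimes> inv r) \<otimes> inv t \<otimes> (t \<otimes> s) \<otimes> (x \<otimes> inv r)) \<otimes> r"
      using key[OF G(2,1) _ sG, of "x \<otimes> inv r"] x G z by simp
    then show "z \<in> ?r" using r t n by blast
  qed
  show "?r \<subseteq> ?l"
  proof
    fix z assume "z \<in> ?r"
    then obtain t r m s where t: "t \<in> T" "r \<in> T" "m \<in> N" "s \<in> K"
      "z = inv (t \<otimes> r) \<otimes> (t \<otimes> inv m \<otimes> inv t \<otimes> (t \<otimes> s) \<otimes> m) \<otimes> r"
      by (auto simp: l_coset_def)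
    have G: "t \<in> carrier G" "r \<in> carrier G" "m \<in> carrier G" "s \<in> carrier G"
      using t T(1) K N.mem_carrier by auto
    then show "z \<in> ?l" using key[OF G] t(4,5) by blast
  qed
qed

lemma (in group) class_subset_carrier:
  fixes \<K> :: "('a, 'b) monoid_scheme \<Rightarrow> 'a set set"
  assumes "\<K> \<in> {Fin, Coset, Rat, Rec, Alg, CF}" "K \<in> \<K> G"
  shows "K \<subseteq> carrier G"
proof -
  have words: "word_eval G ` L \<subseteq> carrier G"
    if A: "finite_generating_set G A" and L: "L \<subseteq> lists (signed_letters A)" for A L
  proof -
    have "A \<subseteq> carrier G" using A by (simp add: finite_generating_set_def)
    then show ?thesis using word_eval_closed[of A] L by blast
  qed
  have "K \<subseteq> carrier G" if K: "K \<in> Coset G"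
  proof -
    obtain S g where "S \<subseteq> carrier G" "g \<in> carrier G" "K = generate G S #> g"
      using K unfolding Coset_def by (elim CollectE exE conjE)
    then show ?thesis using r_coset_subset_G generate_incl by simp
  qed
  moreover have "K \<subseteq> carrier G" if K: "K \<in> Rat G"
  proof -
    obtain A L where AL: "finite_generating_set G A" "L \<in> rational_languages (signed_letters A)"
      "K = word_eval G ` L" using K unfolding Rat_def by (elim CollectE exE conjE)
    show ?thesis using words[OF AL(1) rational_subset_lists[OF AL(2)]] AL(3) by simp
  qed
  moreover have "K \<subseteq> carrier G" if K: "K \<in> Alg G"
  proof -
    obtain A L where AL: "finite_generating_set G A" "L \<in> context_free_languages (signed_letters A)"
      "K = word_eval G ` L" using K unfolding Alg_def by (elim CollectE exE conjE)
    show ?thesis using words[OF AL(1) context_free_subset_lists[OF AL(2)]] AL(3) by simp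
  qed
  moreover have "K \<subseteq> carrier G" if "K \<in> Fin G \<union> Rec G \<union> CF G"
    using that unfolding Fin_def Rec_def CF_def by blast
  ultimately show ?thesis using assms by blast
qed

lemma (in group) generalized_conjugacy_separable_finite_extension:
  fixes \<K> :: "('a, 'b) monoid_scheme \<Rightarrow> 'a set set"
  assumes \<K>: "\<K> \<in> {Fin, Coset, Rat, Rec, Alg, CF}"
    and N: "N \<lhd> G" "finite_index_subgroup N G"
    and sep: "generalized_twisted_conjugacy_separable_Via \<K> (G\<lparr>carrier := N\<rparr>)"
  shows "generalized_conjugacy_separable \<K> G"
  unfolding generalized_conjugacy_separable_def
proof
  interpret N: normal N G by (rule N)
  interpret GN: group "G\<lparr>carrier := N\<rparr>" using N.subgroup_axioms by (rule subgroup_imp_group)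
  fix K assume K: "K \<in> \<K> G"
  have KG: "K \<subseteq> carrier G" using class_subset_carrier[OF \<K> K] .
  obtain R where R: "finite R" "R \<subseteq> carrier G" "\<And>x. x \<in> carrier G \<Longrightarrow> \<exists>t\<in>R. x \<otimes> inv t \<in> N"
    using finite_representatives[OF N(2) subset_refl] by blast
  \<comment> \<open>The coset \<open>N\<close> has to be represented by \<open>\<one>\<close>, as Schreier rewriting demands.\<close>
  define T where "T = insert \<one> (R - N)"
  have T_one: "t \<in> N \<longrightarrow> t = \<one>" if "t \<in> T" for t using that by (auto simp: T_def)
  have fin: "finite T" and TG: "T \<subseteq> carrier G" using R by (auto simp: T_def)
  have T: "\<forall>x\<in>carrier G. \<exists>t\<in>T. x \<otimes> inv t \<in> N"
  proof
    fix x assume x: "x \<in> carrier G"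
    obtain t where t: "t \<in> R" "x \<otimes> inv t \<in> N" using R(3)[OF x] by blast
    show "\<exists>t\<in>T. x \<otimes> inv t \<in> N"
    proof (cases "t \<in> N")
      case True
      have "(x \<otimes> inv t) \<otimes> t \<in> N" using t(2) True by (rule N.m_closed)
      then have "x \<otimes> inv \<one> \<in> N" using x True by (simp add: m_assoc)
      then show ?thesis unfolding T_def by blast
    next
      case False
      then show ?thesis using t unfolding T_def by blast
    qed
  qed
  have "separable G ((\<lambda>z. inv (t \<otimes> r) \<otimes> z \<otimes> r) `
      {t \<otimes> inv m \<otimes> inv t \<otimes> n \<otimes> m | m n. m \<in> N \<and> n \<in> (t <# K) \<inter> N})"
    if t: "t \<in> T" and r: "r \<in> T" for t r
  proof (rule separable_translate[OF separable_finite_index_subgroup[OF N(2)]])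
    have tG: "t \<in> carrier G" using t TG by blast
    show "inv (t \<otimes> r) \<in> carrier G" "r \<in> carrier G" using t r TG by auto
    let ?\<phi> = "\<lambda>y\<in>N. inv (inv t) \<otimes> y \<otimes> inv t"
    have twist: "{t \<otimes> inv m \<otimes> inv t \<otimes> n \<otimes> m | m n. m \<in> N \<and> n \<in> (t <# K) \<inter> N} =
        {?\<phi> (inv\<^bsub>G\<lparr>carrier := N\<rparr>\<^esub> m) \<otimes>\<^bsub>G\<lparr>carrier := N\<rparr>\<^esub> n \<otimes>\<^bsub>G\<lparr>carrier := N\<rparr>\<^esub> m | m n.
          m \<in> carrier (G\<lparr>carrier := N\<rparr>) \<and> n \<in> (t <# K) \<inter> N}"
    proof -
      have "?\<phi> (inv\<^bsub>G\<lparr>carrier := N\<rparr>\<^esub> m) = t \<otimes> inv m \<otimes> inv t" if "m \<in> N" for m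
        using that tG m_inv_consistent[OF N.subgroup_axioms that] by simp
      then show ?thesis by (intro Collect_cong ex_cong1 rev_conj_cong) simp_all
    qed
    have "?\<phi> \<in> Via (G\<lparr>carrier := N\<rparr>)" using conjugation_Via[OF N, of "inv t"] tG by simp
    moreover have "(t <# K) \<inter> N = {} \<or> (t <# K) \<inter> N \<in> \<K> (G\<lparr>carrier := N\<rparr>)"
      using class_translate_restrict[OF N(2) \<K> K tG T_one[OF t]] .
    ultimately have "(t <# K) \<inter> N = {} \<or> separable (G\<lparr>carrier := N\<rparr>)
        {t \<otimes> inv m \<otimes> inv t \<otimes> n \<otimes> m | m n. m \<in> N \<and> n \<in> (t <# K) \<inter> N}"
      using sep unfolding generalized_twisted_conjugacy_separable_Via_def twist by blast
    then show "separable (G\<lparr>carrier := N\<rparr>)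
        {t \<otimes> inv m \<otimes> inv t \<otimes> n \<otimes> m | m n. m \<in> N \<and> n \<in> (t <# K) \<inter> N}"
    proof
      assume "(t <# K) \<inter> N = {}"
      then show ?thesis by (simp add: separable_def)
    qed
  qed
  then show "separable G {inv x \<otimes> s \<otimes> x | x s. x \<in> carrier G \<and> s \<in> K}"
    unfolding conjugacy_closure_decomposition[OF N.subgroup_axioms KG TG T] separable_def
    using fin by (auto intro!: closedin_Union)
qed

theorem corollary4p7:
  fixes \<C> :: "'a monoid set"
    and \<K> :: "'a monoid \<Rightarrow> 'a set set"
    and G :: "'a monoid"
  assumes "\<And>H. H \<in> \<C> \<Longrightarrow> group H \<and> finitely_presented H"
    and "\<And>H U. H \<in> \<C> \<Longrightarrow> finite_index_subgroup U H \<Longrightarrow> H\<lparr>carrier := U\<rparr> \<in> \<C>"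
    and "\<K> \<in> {Fin, Coset, Rat, Rec, Alg, CF}"
    and "\<And>H. H \<in> \<C> \<Longrightarrow> generalized_twisted_conjugacy_separable_Via \<K> H"
    and "group G"
    and "\<exists>U. finite_index_subgroup U G \<and> G\<lparr>carrier := U\<rparr> \<in> \<C>"
  shows "generalized_conjugacy_separable \<K> G"
proof -
  interpret group G by (rule assms(5))
  obtain U where U: "finite_index_subgroup U G" "G\<lparr>carrier := U\<rparr> \<in> \<C>" using assms(6) by blast
  obtain N where N: "N \<lhd> G" "finite_index_subgroup N G" "N \<subseteq> U"
    using finite_index_normal_core[OF U(1)] by blast
  have "finite_index_subgroup N (G\<lparr>carrier := U\<rparr>)"
    using finite_index_restrict[OF N(2) _ N(3)] U(1) by (simp add: finite_index_subgroup_def)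
  then have "G\<lparr>carrier := N\<rparr> \<in> \<C>" using assms(2)[OF U(2)] by simp
  then show ?thesis
    using generalized_conjugacy_separable_finite_extension[OF assms(3) N(1,2)] assms(4) by blast
qed

end
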